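(* Let $X$ be a connected topological space admitting a universal covering space $\widetilde X$, with $H^1(X;\mathbb{Z})=0$. Let $c\in H^2(X;\mathbb{Z})$ be a non-zero class that is equal to zero in $H^2(X;\mathbb{R})$, let $G=\mathrm{Homeo}(X,c)$ be the group of $c$-preserving homeomorphisms of $X$, and let $\rho\in H^1(X;S^1)$ be a class whose image under the connecting homomorphism $H^1(X;S^1)\to H^2(X;\mathbb{Z})$ is $c$. Let $\alpha\in C^1(X;S^1)$ be a singular cocycle representing $\rho$ and let $x\in X$. Then the cohomology class $[\mathfrak{G}_{x,\alpha}]$ of the group two-cocycle $\mathfrak{G}_{x,\alpha}$ on $G$ is equal to $e(\mathrm{Aut}(P_\rho^\delta))\in H^2_{\mathrm{grp}}(G;S^1)$.
   Context: $S^1=\mathbb{R}/\mathbb{Z}$; $(S^1)^\delta$ is $S^1$ with the discrete topology. The cocycle $\mathfrak{G}_{x,\alpha}$: let $(C^*(X;S^1),d)$ be the singular cochain complex of $X$ with coefficients in $S^1$, on which $G$ acts on the right by pullback. The group of $\rho$-preserving homeomorphisms of $X$ is equal to $G$; hence for each $g\in G$ there is $\mathfrak{K}_\alpha(g)\in C^0(X;S^1)$ with $g^*\alpha-\alpha=d\mathfrak{K}_\alpha(g)$. Define $$\mathfrak{G}_{x,\alpha}(g,h)=\int_x^{hx}(g^*\alpha-\alpha)=\mathfrak{K}_\alpha(g)(hx)-\mathfrak{K}_\alpha(g)(x)\in S^1,\qquad g,h\in G,$$ where $\int_x^{hx}$ denotes the pairing of the cocycle $g^*\alpha-\alpha$ with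 a path from $x$ to $hx$. This is a group two-cocycle in $C^2_{\mathrm{grp}}(G;S^1)$ (trivial $G$-module $S^1$), whose class is independent of $x$ and of the representative $\alpha$. The extension: regard $\rho$ as a homomorphism $\pi_1(X)\to S^1$ and let $P_\rho^\delta=\widetilde X\times_\rho(S^1)^\delta$ be the principal $(S^1)^\delta$-bundle over $X$ with holonomy $\rho$ (a lift $\widetilde\gamma$ of a loop $\gamma$ satisfies $\widetilde\gamma(1)=\widetilde\gamma(0)\cdot\rho(\gamma)$). Its bundle automorphism group fits into a central extension $1\to S^1\to\mathrm{Aut}(P_\rho^\delta)\to G\to1$, where $S^1$ acts by the principal action. The class $e(\mathrm{Aut}(P_\rho^\delta))$ is represented by $(g,h)\mapsto s(g)s(h)s(gh)^{-1}\in S^1$ for any set-theoretic section $s\colon G\to\mathrm{Aut}(P_\rho^\delta)$.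
   Formalization: That the ρ-preserving homeomorphisms form exactly G is assumed: it can fail when H^1(X;R) ≠ 0 (e.g. X = BQ × RP^2), and then the cocycle is undefined. A universal covering is taken to be simply connected and universal among connected coverings. *)

theory Defs
  imports "HOL-Homology.Homology" "HOL-Algebra.Bij"
begin

section \<open>The circle group\<close>

text \<open>\<open>S\<^sup>1 = \<real>/\<int>\<close>, written additively. The type carries no topology; where one is needed
  (for \<open>(S\<^sup>1)\<^sup>\<delta>\<close>) it is the discrete one.\<close>

quotient_type circle = real / "\<lambda>x y. x - y \<in> \<int>"
proof (rule equivpI)
  show "reflp (\<lambda>x y::real. x - y \<in> \<int>)"
    by (simp add: reflp_def)
  show "symp (\<lambda>x y::real. x - y \<in> \<int>)"
    by (metis (no_types, lifting) Ints_minus minus_diff_eq sympI)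
  show "transp (\<lambda>x y::real. x - y \<in> \<int>)"
    by (rule transpI) (metis Ints_add add_diff_eq diff_add_cancel)
qed

instantiation circle :: ab_group_add
begin

lift_definition zero_circle :: circle is "0 :: real" .

lift_definition plus_circle :: "circle \<Rightarrow> circle \<Rightarrow> circle" is "(+)"
  by (metis (no_types, lifting) Ints_add add_diff_add)

lift_definition uminus_circle :: "circle \<Rightarrow> circle" is "uminus"
  by (metis Ints_minus minus_diff_minus)

lift_definition minus_circle :: "circle \<Rightarrow> circle \<Rightarrow> circle" is "(-)"
  by (metis (no_types, lifting) Ints_diff diff_diff_eq2 diff_add_eq add_diff_eq diff_diff_add add.commute)

instance
  by (standard; transfer; simp add: algebra_simps)

end

lift_definition circle_of :: "real \<Rightarrow> circle" is "\<lambda>x. x" .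


section \<open>Singular cohomology\<close>

text \<open>A cochain with values in \<open>'c\<close> is given by its values on the singular simplices, the basis of
  the chain group; it is normalised to vanish off the singular \<open>n\<close>-simplices of the space, so that
  equality of cochains is equality of functions.\<close>

type_synonym ('a, 'c) cochain = "((nat \<Rightarrow> real) \<Rightarrow> 'a) \<Rightarrow> 'c"

definition cochains :: "nat \<Rightarrow> 'a topology \<Rightarrow> ('a, 'c::ab_group_add) cochain set" where
  "cochains n X = {f. \<forall>\<sigma>. \<not> singular_simplex n X \<sigma> \<longrightarrow> f \<sigma> = 0}"

text \<open>\<open>d f = f \<circ> \<partial>\<close>, with no further sign; compare \<^const>\<open>chain_boundary\<close>.\<close>

definition cobdry :: "nat \<Rightarrow> 'a topology \<Rightarrow> ('a, 'c::ab_group_add) cochain \<Rightarrow> ('a, 'c) cochain" where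
  "cobdry n X f = (\<lambda>\<sigma>. if singular_simplex (Suc n) X \<sigma>
     then \<Sum>k\<le>Suc n. (if even k then f (singular_face (Suc n) k \<sigma>)
                               else - f (singular_face (Suc n) k \<sigma>))
     else 0)"

definition cocycle_group :: "nat \<Rightarrow> 'a topology \<Rightarrow> ('a, 'c::ab_group_add) cochain monoid" where
  "cocycle_group n X = \<lparr>carrier = {f \<in> cochains n X. cobdry n X f = (\<lambda>\<sigma>. 0)},
                        mult = (\<lambda>f g \<sigma>. f \<sigma> + g \<sigma>), one = (\<lambda>\<sigma>. 0)\<rparr>"

definition coboundaries :: "nat \<Rightarrow> 'a topology \<Rightarrow> ('a, 'c::ab_group_add) cochain set" where
  "coboundaries n X =
     (if n = 0 then {\<lambda>\<sigma>. 0} else cobdry (n - 1) X ` cochains (n - 1) X)"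

definition cohomology_group :: "nat \<Rightarrow> 'a topology \<Rightarrow> ('a, 'c::ab_group_add) cochain set monoid" where
  "cohomology_group n X = cocycle_group n X Mod coboundaries n X"

definition cohom_class ::
    "nat \<Rightarrow> 'a topology \<Rightarrow> ('a, 'c::ab_group_add) cochain \<Rightarrow> ('a, 'c) cochain set" where
  "cohom_class n X f = coboundaries n X #>\<^bsub>cocycle_group n X\<^esub> f"

text \<open>Cohomology classes are cosets of cocycles. A map induced on classes is given below as the
  union of the classes of the images of all representatives; these classes all coincide.\<close>

definition coeff_map :: "nat \<Rightarrow> 'a topology \<Rightarrow> ('c \<Rightarrow> 'd) \<Rightarrow>
    ('a, 'c::ab_group_add) cochain set \<Rightarrow> ('a, 'd::ab_group_add) cochain set" where
  "coeff_map n X j C = (\<Union>f\<in>C. cohom_class n X (j \<circ> f))"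

text \<open>Connecting homomorphism \<open>H\<^sup>n(X;S\<^sup>1) \<rightarrow> H\<^sup>n\<^sup>+\<^sup>1(X;\<int>)\<close> of \<open>0 \<rightarrow> \<int> \<rightarrow> \<real> \<rightarrow> S\<^sup>1 \<rightarrow> 0\<close>: lift a
  representative to a real cochain \<open>r\<close>; then \<open>d r\<close> is an integral cocycle \<open>z\<close>.\<close>

definition connecting_hom ::
    "nat \<Rightarrow> 'a topology \<Rightarrow> ('a, circle) cochain set \<Rightarrow> ('a, int) cochain set" where
  "connecting_hom n X C =
     \<Union>{cohom_class (Suc n) X z | f r z.
          f \<in> C \<and> r \<in> cochains n X \<and> z \<in> cochains (Suc n) X \<and>
          circle_of \<circ> r = f \<and> real_of_int \<circ> z = cobdry n X r}"

definition pullback :: "nat \<Rightarrow> 'a topology \<Rightarrow> ('a \<Rightarrow> 'a) \<Rightarrow>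
    ('a, 'c::ab_group_add) cochain \<Rightarrow> ('a, 'c) cochain" where
  "pullback n X g f = (\<lambda>\<sigma>. if singular_simplex n X \<sigma> then f (simplex_map n g \<sigma>) else 0)"

definition pullback_class :: "nat \<Rightarrow> 'a topology \<Rightarrow> ('a \<Rightarrow> 'a) \<Rightarrow>
    ('a, 'c::ab_group_add) cochain set \<Rightarrow> ('a, 'c) cochain set" where
  "pullback_class n X g C = (\<Union>f\<in>C. cohom_class n X (pullback n X g f))"

text \<open>The group \<open>Homeo(X,C)\<close> for \<open>C \<in> H\<^sup>n(X;A)\<close>, under composition.\<close>

definition homeo_group ::
    "nat \<Rightarrow> 'a topology \<Rightarrow> ('a, 'c::ab_group_add) cochain set \<Rightarrow> ('a \<Rightarrow> 'a) monoid" where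
  "homeo_group n X C = BijGroup (topspace X)
     \<lparr>carrier := {g \<in> Bij (topspace X). homeomorphic_map X X g \<and> pullback_class n X g C = C}\<rparr>"

definition point_simplex :: "'a \<Rightarrow> (nat \<Rightarrow> real) \<Rightarrow> 'a" where
  "point_simplex y = restrict (\<lambda>_. y) (standard_simplex 0)"

text \<open>The singular 1-simplex of a path \<open>\<gamma>\<close>; its boundary is \<open>\<gamma> 1 - \<gamma> 0\<close>.\<close>

definition path_simplex :: "(real \<Rightarrow> 'a) \<Rightarrow> (nat \<Rightarrow> real) \<Rightarrow> 'a" where
  "path_simplex \<gamma> = restrict (\<lambda>u. \<gamma> (u 1)) (standard_simplex 1)"

text \<open>A class \<open>\<rho> \<in> H\<^sup>1(X;S\<^sup>1)\<close> as a homomorphism on loops: all representatives of \<open>\<rho>\<close> have the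
  same value on a loop.\<close>

definition loop_value :: "('a, circle) cochain set \<Rightarrow> (real \<Rightarrow> 'a) \<Rightarrow> circle" where
  "loop_value \<rho> \<gamma> = the_elem ((\<lambda>f. f (path_simplex \<gamma>)) ` \<rho>)"


section \<open>Degree two group cohomology with trivial coefficients\<close>

definition grp_cocycles2 :: "('g, 'm) monoid_scheme \<Rightarrow> ('g \<Rightarrow> 'g \<Rightarrow> 'c::ab_group_add) monoid" where
  "grp_cocycles2 G =
     \<lparr>carrier = {f. (\<forall>g h. \<not> (g \<in> carrier G \<and> h \<in> carrier G) \<longrightarrow> f g h = 0) \<and>
                    (\<forall>g\<in>carrier G. \<forall>h\<in>carrier G. \<forall>k\<in>carrier G.
                       f h k - f (g \<otimes>\<^bsub>G\<^esub> h) k + f g (h \<otimes>\<^bsub>G\<^esub> k) - f g h = 0)},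
      mult = (\<lambda>f f' g h. f g h + f' g h), one = (\<lambda>g h. 0)\<rparr>"

definition grp_coboundaries2 :: "('g, 'm) monoid_scheme \<Rightarrow> ('g \<Rightarrow> 'g \<Rightarrow> 'c::ab_group_add) set" where
  "grp_coboundaries2 G = range (\<lambda>\<kappa> g h. if g \<in> carrier G \<and> h \<in> carrier G
                                          then \<kappa> h - \<kappa> (g \<otimes>\<^bsub>G\<^esub> h) + \<kappa> g else 0)"

definition grp_cohomology2 ::
    "('g, 'm) monoid_scheme \<Rightarrow> ('g \<Rightarrow> 'g \<Rightarrow> 'c::ab_group_add) set monoid" where
  "grp_cohomology2 G = grp_cocycles2 G Mod grp_coboundaries2 G"

definition grp_class2 ::
    "('g, 'm) monoid_scheme \<Rightarrow> ('g \<Rightarrow> 'g \<Rightarrow> 'c::ab_group_add) \<Rightarrow> ('g \<Rightarrow> 'g \<Rightarrow> 'c) set" where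
  "grp_class2 G f = grp_coboundaries2 G #>\<^bsub>grp_cocycles2 G\<^esub> f"

text \<open>The class of a central extension \<open>1 \<rightarrow> A \<rightarrow> E \<rightarrow> G \<rightarrow> 1\<close> with maps \<open>\<iota>\<close> and \<open>\<pi>\<close>: the common
  class of the cocycles \<open>s(g) s(h) s(gh)\<^sup>-\<^sup>1\<close> over all set-theoretic sections \<open>s\<close>. If \<open>\<pi>\<close> has no
  section this is empty, and hence not a class.\<close>

definition section_cocycle :: "('c::ab_group_add \<Rightarrow> 'e) \<Rightarrow> ('e, 'n) monoid_scheme \<Rightarrow>
    ('g, 'm) monoid_scheme \<Rightarrow> ('g \<Rightarrow> 'e) \<Rightarrow> 'g \<Rightarrow> 'g \<Rightarrow> 'c" where
  "section_cocycle \<iota> E G s = (\<lambda>g h. if g \<in> carrier G \<and> h \<in> carrier G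
     then THE a. \<iota> a = s g \<otimes>\<^bsub>E\<^esub> s h \<otimes>\<^bsub>E\<^esub> inv\<^bsub>E\<^esub> s (g \<otimes>\<^bsub>G\<^esub> h) else 0)"

definition extension_class :: "('c::ab_group_add \<Rightarrow> 'e) \<Rightarrow> ('e, 'n) monoid_scheme \<Rightarrow>
    ('e \<Rightarrow> 'g) \<Rightarrow> ('g, 'm) monoid_scheme \<Rightarrow> ('g \<Rightarrow> 'g \<Rightarrow> 'c) set" where
  "extension_class \<iota> E \<pi> G =
     \<Union>{grp_class2 G (section_cocycle \<iota> E G s) | s.
          s \<in> carrier G \<rightarrow> carrier E \<and> (\<forall>g\<in>carrier G. \<pi> (s g) = g)}"


section \<open>The cocycle attached to a singular cocycle and a base point\<close>

text \<open>A potential exists exactly when \<open>g\<close> preserves the class \<open>\<rho>\<close> of \<open>\<alpha>\<close>. That every element of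
  \<open>Homeo(X,c)\<close> does so, for \<open>c\<close> the image of \<open>\<rho>\<close> under the connecting homomorphism, is a genuine
  condition: vanishing of \<open>H\<^sup>1(X;\<int>)\<close> does not imply vanishing of \<open>H\<^sup>1(X;\<real>)\<close> when \<open>H\<^sub>1(X)\<close> is not
  finitely generated.\<close>

definition potential ::
    "'a topology \<Rightarrow> ('a, circle) cochain \<Rightarrow> ('a \<Rightarrow> 'a) \<Rightarrow> ('a, circle) cochain" where
  "potential X \<alpha> g = (SOME \<kappa>. \<kappa> \<in> cochains 0 X \<and>
                             (\<lambda>\<sigma>. pullback 1 X g \<alpha> \<sigma> - \<alpha> \<sigma>) = cobdry 0 X \<kappa>)"

definition basepoint_cocycle :: "('a \<Rightarrow> 'a, 'm) monoid_scheme \<Rightarrow> 'a topology \<Rightarrow> 'a \<Rightarrow>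
    ('a, circle) cochain \<Rightarrow> ('a \<Rightarrow> 'a) \<Rightarrow> ('a \<Rightarrow> 'a) \<Rightarrow> circle" where
  "basepoint_cocycle G X x \<alpha> = (\<lambda>g h. if g \<in> carrier G \<and> h \<in> carrier G
     then potential X \<alpha> g (point_simplex (h x)) - potential X \<alpha> g (point_simplex x) else 0)"


section \<open>Universal coverings\<close>

text \<open>The versions of \<^const>\<open>covering_space\<close> and \<^const>\<open>simply_connected\<close> for \<open>'a topology\<close>.\<close>

definition covering_map :: "'b topology \<Rightarrow> ('b \<Rightarrow> 'a) \<Rightarrow> 'a topology \<Rightarrow> bool" where
  "covering_map E p X \<longleftrightarrow>
     continuous_map E X p \<and> p ` topspace E = topspace X \<and>
     (\<forall>x\<in>topspace X. \<exists>U. x \<in> U \<and> openin X U \<and>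
        (\<exists>\<V>. \<Union>\<V> = topspace E \<inter> p -` U \<and> (\<forall>V\<in>\<V>. openin E V) \<and> pairwise disjnt \<V> \<and>
             (\<forall>V\<in>\<V>. homeomorphic_map (subtopology E V) (subtopology X U) p)))"

definition simply_connected_space :: "'b topology \<Rightarrow> bool" where
  "simply_connected_space E \<longleftrightarrow>
     path_connected_space E \<and>
     (\<forall>\<gamma>. pathin E \<gamma> \<and> \<gamma> 1 = \<gamma> 0 \<longrightarrow>
        homotopic_with (\<lambda>\<eta>. \<eta> 0 = \<gamma> 0 \<and> \<eta> 1 = \<gamma> 0) (top_of_set {0..1}) E \<gamma> (\<lambda>t. \<gamma> 0))"

text \<open>A universal covering is a simply connected covering that maps, with prescribed base points,
  to every connected covering of \<open>X\<close>. For locally path-connected \<open>X\<close> the second property follows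
  from the first by the lifting criterion; in general it does not, and it is what makes the fundamental
  group of \<open>X\<close> act on \<open>E\<close> by deck transformations, transitively on fibres. The competing coverings
  range over the type of the total space only, which makes the requirement weaker.\<close>

definition universal_covering :: "'b topology \<Rightarrow> ('b \<Rightarrow> 'a) \<Rightarrow> 'a topology \<Rightarrow> bool" where
  "universal_covering E p X \<longleftrightarrow>
     covering_map E p X \<and> simply_connected_space E \<and>
     (\<forall>(Y::'b topology) q. covering_map Y q X \<and> connected_space Y \<longrightarrow>
        (\<forall>e\<in>topspace E. \<forall>y\<in>topspace Y. p e = q y \<longrightarrow>
           (\<exists>f. continuous_map E Y f \<and> f e = y \<and> (\<forall>z\<in>topspace E. q (f z) = p z))))"

definition deck_transformation :: "'b topology \<Rightarrow> ('b \<Rightarrow> 'a) \<Rightarrow> ('b \<Rightarrow> 'b) \<Rightarrow> bool" where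
  "deck_transformation E p \<phi> \<longleftrightarrow>
     homeomorphic_map E E \<phi> \<and> (\<forall>z\<in>topspace E. p (\<phi> z) = p z)"


section \<open>The flat circle bundle with given holonomy\<close>

definition quotient_topology :: "'b topology \<Rightarrow> ('b \<times> 'b) set \<Rightarrow> 'b set topology" where
  "quotient_topology T r =
     topology (\<lambda>U. U \<subseteq> topspace T // r \<and> openin T {e \<in> topspace T. r `` {e} \<in> U})"

lemma openin_quotient_topology:
  "openin (quotient_topology T r) U \<longleftrightarrow>
     U \<subseteq> topspace T // r \<and> openin T {e \<in> topspace T. r `` {e} \<in> U}"
proof -
  have "istopology (\<lambda>U. U \<subseteq> topspace T // r \<and> openin T {e \<in> topspace T. r `` {e} \<in> U})"
    unfolding istopology_def
  proof (intro conjI allI impI)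
    fix S U
    assume "S \<subseteq> topspace T // r \<and> openin T {e \<in> topspace T. r `` {e} \<in> S}"
      and "U \<subseteq> topspace T // r \<and> openin T {e \<in> topspace T. r `` {e} \<in> U}"
    moreover have "{e \<in> topspace T. r `` {e} \<in> S \<inter> U} =
        {e \<in> topspace T. r `` {e} \<in> S} \<inter> {e \<in> topspace T. r `` {e} \<in> U}"
      by blast
    ultimately show "S \<inter> U \<subseteq> topspace T // r" "openin T {e \<in> topspace T. r `` {e} \<in> S \<inter> U}"
      by auto
  next
    fix \<K>
    assume "\<forall>S\<in>\<K>. S \<subseteq> topspace T // r \<and> openin T {e \<in> topspace T. r `` {e} \<in> S}"
    moreover have "{e \<in> topspace T. r `` {e} \<in> \<Union>\<K>} = (\<Union>S\<in>\<K>. {e \<in> topspace T. r `` {e} \<in> S})"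
      by blast
    ultimately show "\<Union>\<K> \<subseteq> topspace T // r" "openin T {e \<in> topspace T. r `` {e} \<in> \<Union>\<K>}"
      by auto
  qed
  then show ?thesis
    by (simp add: quotient_topology_def topology_inverse')
qed

text \<open>The relation defining \<open>E \<times>\<^sub>\<rho> (S\<^sup>1)\<^sup>\<delta>\<close>. The deck transformation \<open>\<phi>\<close> corresponds to the loop
  \<open>p \<circ> \<gamma>\<close> for a path \<open>\<gamma>\<close> from \<open>z\<close> to \<open>\<phi> z\<close>, and \<open>[\<phi> z, s] = [z, s + \<rho>(p \<circ> \<gamma>)]\<close>. Thus the lift
  \<open>t \<mapsto> [\<gamma> t, s]\<close> of the loop \<open>p \<circ> \<gamma>\<close> ends at its starting point translated by \<open>\<rho>(p \<circ> \<gamma>)\<close>.\<close>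

definition holonomy_rel :: "'b topology \<Rightarrow> ('b \<Rightarrow> 'a) \<Rightarrow> ('a, circle) cochain set \<Rightarrow>
    (('b \<times> circle) \<times> ('b \<times> circle)) set" where
  "holonomy_rel E p \<rho> =
     {((\<phi> z, s), (z, s + loop_value \<rho> (p \<circ> \<gamma>))) | \<phi> \<gamma> z s.
        deck_transformation E p \<phi> \<and> z \<in> topspace E \<and> pathin E \<gamma> \<and> \<gamma> 0 = z \<and> \<gamma> 1 = \<phi> z}"

definition flat_bundle :: "'b topology \<Rightarrow> ('b \<Rightarrow> 'a) \<Rightarrow> ('a, circle) cochain set \<Rightarrow>
    ('b \<times> circle) set topology" where
  "flat_bundle E p \<rho> =
     quotient_topology (prod_topology E (discrete_topology UNIV)) (holonomy_rel E p \<rho>)"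

definition bundle_proj :: "('b \<Rightarrow> 'a) \<Rightarrow> ('b \<times> circle) set \<Rightarrow> 'a" where
  "bundle_proj p u = the_elem ((p \<circ> fst) ` u)"

definition principal_action :: "circle \<Rightarrow> ('b \<times> circle) set \<Rightarrow> ('b \<times> circle) set" where
  "principal_action t u = (\<lambda>(z, s). (z, s + t)) ` u"

text \<open>Bundle automorphisms are the equivariant homeomorphisms of the total space; they need not
  cover the identity of the base.\<close>

definition bundle_aut_group :: "'b topology \<Rightarrow> ('b \<Rightarrow> 'a) \<Rightarrow> ('a, circle) cochain set \<Rightarrow>
    (('b \<times> circle) set \<Rightarrow> ('b \<times> circle) set) monoid" where
  "bundle_aut_group E p \<rho> = (let P = flat_bundle E p \<rho> in BijGroup (topspace P)
     \<lparr>carrier := {\<Phi> \<in> Bij (topspace P). homeomorphic_map P P \<Phi> \<and>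
        (\<forall>u\<in>topspace P. \<forall>t. \<Phi> (principal_action t u) = principal_action t (\<Phi> u))}\<rparr>)"

definition bundle_translation :: "'b topology \<Rightarrow> ('b \<Rightarrow> 'a) \<Rightarrow> ('a, circle) cochain set \<Rightarrow>
    circle \<Rightarrow> ('b \<times> circle) set \<Rightarrow> ('b \<times> circle) set" where
  "bundle_translation E p \<rho> t = restrict (principal_action t) (topspace (flat_bundle E p \<rho>))"

definition covered_map :: "'b topology \<Rightarrow> ('b \<Rightarrow> 'a) \<Rightarrow> 'a topology \<Rightarrow> ('a, circle) cochain set \<Rightarrow>
    (('b \<times> circle) set \<Rightarrow> ('b \<times> circle) set) \<Rightarrow> 'a \<Rightarrow> 'a" where
  "covered_map E p X \<rho> \<Phi> = (\<lambda>y\<in>topspace X.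
     the_elem ((bundle_proj p \<circ> \<Phi>) ` {u \<in> topspace (flat_bundle E p \<rho>). bundle_proj p u = y}))"

definition aut_extension_class :: "'b topology \<Rightarrow> ('b \<Rightarrow> 'a) \<Rightarrow> 'a topology \<Rightarrow>
    ('a, circle) cochain set \<Rightarrow> ('a \<Rightarrow> 'a, 'm) monoid_scheme \<Rightarrow>
    (('a \<Rightarrow> 'a) \<Rightarrow> ('a \<Rightarrow> 'a) \<Rightarrow> circle) set" where
  "aut_extension_class E p X \<rho> G =
     extension_class (bundle_translation E p \<rho>) (bundle_aut_group E p \<rho>) (covered_map E p X \<rho>) G"

end

theory Submission
  imports Defs
begin

text \<open>
  Let \<open>F\<close> be a primitive on the universal covering \<open>p: E \<rightarrow> X\<close> of the pulled back cocycle \<open>p\<^sup>*\<alpha>\<close>; it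
  exists because \<open>E\<close> is simply connected (\<open>simply_connected_cocycle_primitive\<close>). The holonomy of a loop
  that lifts to a path in \<open>E\<close> is the increment of \<open>F\<close> along the lift, so a point \<open>[e, s]\<close> of the flat
  bundle is determined by its projection \<open>p e\<close> and its phase \<open>s + F e\<close> (\<open>holonomy_rel_eq\<close>). In these
  coordinates the bundle is \<open>X \<times> S\<^sup>1\<close> with the translation action, and only its topology is twisted.

  Let \<open>K\<^sub>g\<close> be a potential of \<open>g\<^sup>*\<alpha> - \<alpha>\<close>. A lift \<open>f\<close> of \<open>g\<close> to \<open>E\<close>, acting on \<open>E \<times> S\<^sup>1\<close> through the
  first factor, descends to a bundle automorphism over \<open>g\<close>, because \<open>F \<circ> f - F\<close> and \<open>K\<^sub>g \<circ> p\<close> differ by a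
  constant. So this automorphism is \<open>(y, a) \<mapsto> (g y, a + K\<^sub>g(y) + const)\<close> in coordinates
  (\<open>aut_over_homeomorphism\<close>). Because the structure group is discrete, horizontal sheets are open
  (\<open>openin_slice\<close>), and two equivariant continuous maps over the same map differ by a constant
  translation (\<open>equivariant_maps_differ_by_constant\<close>). Hence every automorphism over \<open>g\<close> has that
  form (\<open>aut_phase\<close>).

  For an arbitrary section \<open>s\<close> with constants \<open>k(g)\<close>, comparing the phases of \<open>s(g) s(h)\<close> and \<open>s(gh)\<close>
  over the base point gives
  \<open>K\<^sub>g(hx) + K\<^sub>h(x) - K\<^sub>g\<^sub>h(x) + k(g) + k(h) - k(gh)\<close> for the extension cocycle (\<open>section_cocycle_eq\<close>).
  The base point cocycle is \<open>K\<^sub>g(hx) - K\<^sub>g(x)\<close>, and the difference of the two is the coboundary of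
  \<open>\<kappa>(g) = K\<^sub>g(x) + k(g)\<close>.
\<close>

section \<open>Coverings and lifts\<close>

lemma locally_constant_imp_constant:
  assumes "connected_space T"
    and loc: "\<And>t. t \<in> topspace T \<Longrightarrow> \<exists>U. openin T U \<and> t \<in> U \<and> (\<forall>t'\<in>U. \<kappa> t' = \<kappa> t)"
    and "a \<in> topspace T" "b \<in> topspace T"
  shows "\<kappa> a = \<kappa> b"
proof (rule ccontr)
  assume ne: "\<kappa> a \<noteq> \<kappa> b"
  have "openin T {t \<in> topspace T. \<kappa> t \<in> S}" for S
    using loc by (subst openin_subopen) (smt (verit) mem_Collect_eq openin_subset subset_iff)
  from this[of "{\<kappa> a}"] this[of "- {\<kappa> a}"]
  have "openin T {t \<in> topspace T. \<kappa> t = \<kappa> a}" "openin T {t \<in> topspace T. \<kappa> t \<noteq> \<kappa> a}"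
    by auto
  moreover define A B where "A = {t \<in> topspace T. \<kappa> t = \<kappa> a}" and "B = {t \<in> topspace T. \<kappa> t \<noteq> \<kappa> a}"
  ultimately have "openin T A" "openin T B" "topspace T \<subseteq> A \<union> B" "A \<inter> B = {}" "A \<noteq> {}" "B \<noteq> {}"
    using assms(3,4) ne by auto
  then show False
    using assms(1) unfolding connected_space_def by meson
qed

lemma continuous_map_nhd:
  assumes "continuous_map T Y f" "openin Y U" "t \<in> topspace T" "f t \<in> U"
  obtains N where "openin T N" "t \<in> N" "\<And>t'. t' \<in> N \<Longrightarrow> f t' \<in> U"
  using openin_continuous_map_preimage[OF assms(1,2)] assms(3,4) by (metis (mono_tags, lifting) mem_Collect_eq)

lemma covering_map_locally_injective:
  assumes "covering_map E p X" "e \<in> topspace E"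
  obtains V where "openin E V" "e \<in> V" "inj_on p V"
proof -
  have "p e \<in> topspace X"
    using assms by (auto simp: covering_map_def)
  then obtain U \<V> where U: "p e \<in> U" "openin X U" "\<Union>\<V> = topspace E \<inter> p -` U"
      "\<forall>V\<in>\<V>. openin E V" "\<forall>V\<in>\<V>. homeomorphic_map (subtopology E V) (subtopology X U) p"
    using assms(1) unfolding covering_map_def by meson
  with assms(2) obtain V where V: "V \<in> \<V>" "e \<in> V"
    by blast
  then have "inj_on p V"
    using U homeomorphic_imp_injective_map[of "subtopology E V"] openin_subset[of E V]
    by (metis inf.absorb_iff2 topspace_subtopology)
  with V U that show ?thesis by blast
qed

lemma covering_map_separates_fibre:
  assumes "covering_map E p X" "e \<in> topspace E" "e' \<in> topspace E" "p e = p e'" "e \<noteq> e'"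
  obtains V V' where "openin E V" "openin E V'" "e \<in> V" "e' \<in> V'" "V \<inter> V' = {}"
proof -
  have "p e \<in> topspace X"
    using assms by (auto simp: covering_map_def)
  then obtain U \<V> where U: "p e \<in> U" "\<Union>\<V> = topspace E \<inter> p -` U" "pairwise disjnt \<V>"
      "\<forall>V\<in>\<V>. openin E V" "\<forall>V\<in>\<V>. homeomorphic_map (subtopology E V) (subtopology X U) p"
    using assms(1) unfolding covering_map_def by meson
  with assms(2-4) obtain V V' where V: "V \<in> \<V>" "e \<in> V" "V' \<in> \<V>" "e' \<in> V'"
    by (metis Int_iff UnionE vimage_eq)
  have "inj_on p V"
    using U V homeomorphic_imp_injective_map[of "subtopology E V"] openin_subset[of E V]
    by (metis inf.absorb_iff2 topspace_subtopology)
  then have "V \<noteq> V'"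
    using V assms(4,5) by (auto dest: inj_onD)
  then have "V \<inter> V' = {}"
    using U V by (metis disjnt_def pairwiseD)
  then show ?thesis
    using that[of V V'] U(4) V by simp
qed

text \<open>Agreement of the two lifts is a locally constant property of the point: where they agree, an open
  set on which \<open>p\<close> is injective keeps them together; where they differ, disjoint sheets keep them
  apart.\<close>

lemma covering_lift_unique:
  assumes cov: "covering_map E p X" and T: "connected_space T"
    and f: "continuous_map T E f" and f': "continuous_map T E f'"
    and over: "\<And>t. t \<in> topspace T \<Longrightarrow> p (f t) = p (f' t)"
    and a: "a \<in> topspace T" "f a = f' a" and b: "b \<in> topspace T"
  shows "f b = f' b"
proof -
  have "\<exists>U. openin T U \<and> t \<in> U \<and> (\<forall>t'\<in>U. (f t' = f' t') = (f t = f' t))"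
    if t: "t \<in> topspace T" for t
  proof (cases "f t = f' t")
    case True
    have "f t \<in> topspace E"
      using f t by (auto simp: continuous_map_def)
    from covering_map_locally_injective[OF cov this]
    obtain V where V: "openin E V" "f t \<in> V" "inj_on p V" .
    obtain N where N: "openin T N" "t \<in> N" "\<And>t'. t' \<in> N \<Longrightarrow> f t' \<in> V"
      using continuous_map_nhd[OF f V(1) t V(2)] by blast
    obtain N' where N': "openin T N'" "t \<in> N'" "\<And>t'. t' \<in> N' \<Longrightarrow> f' t' \<in> V"
      using continuous_map_nhd[OF f' V(1) t] V(2) True by metis
    have "f t' = f' t'" if "t' \<in> N \<inter> N'" for t'
      using that N N' V(3) over openin_subset[OF N(1)] by (metis IntE inj_onD subset_iff)
    then show ?thesis
      using N N' True by (intro exI[of _ "N \<inter> N'"]) auto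
  next
    case False
    have "f t \<in> topspace E" "f' t \<in> topspace E"
      using f f' t by (auto simp: continuous_map_def)
    from covering_map_separates_fibre[OF cov this over[OF t] False]
    obtain V V' where V: "openin E V" "openin E V'" "f t \<in> V" "f' t \<in> V'" "V \<inter> V' = {}" .
    obtain N where N: "openin T N" "t \<in> N" "\<And>t'. t' \<in> N \<Longrightarrow> f t' \<in> V"
      using continuous_map_nhd[OF f V(1) t V(3)] by blast
    obtain N' where N': "openin T N'" "t \<in> N'" "\<And>t'. t' \<in> N' \<Longrightarrow> f' t' \<in> V'"
      using continuous_map_nhd[OF f' V(2) t V(4)] by blast
    have "f t' \<noteq> f' t'" if "t' \<in> N \<inter> N'" for t'
      using that N(3) N'(3) V(5) by (metis IntD1 IntD2 IntI empty_iff)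
    then show ?thesis
      using N N' False by (intro exI[of _ "N \<inter> N'"]) auto
  qed
  from locally_constant_imp_constant[where \<kappa> = "\<lambda>t. f t = f' t", OF T this a(1) b] a(2)
  show ?thesis by blast
qed

lemma covering_map_compose_homeomorphism:
  assumes cov: "covering_map E p X" and g: "homeomorphic_map X X g"
  shows "covering_map E (g \<circ> p) X"
proof -
  have ginj: "inj_on g (topspace X)" and gsurj: "g ` topspace X = topspace X"
    using g by (auto simp: homeomorphic_eq_everything_map)
  have p: "continuous_map E X p" "p ` topspace E = topspace X"
    using cov by (auto simp: covering_map_def)
  show ?thesis
    unfolding covering_map_def
  proof (intro conjI ballI)
    show "continuous_map E X (g \<circ> p)"
      by (rule continuous_map_compose[OF p(1) homeomorphic_imp_continuous_map[OF g]])
    show "(g \<circ> p) ` topspace E = topspace X"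
      using p gsurj by (metis image_comp)
    fix y assume "y \<in> topspace X"
    then obtain y0 where y0: "y0 \<in> topspace X" "g y0 = y"
      using gsurj by (metis imageE)
    then obtain U \<V> where U: "y0 \<in> U" "openin X U" "\<Union>\<V> = topspace E \<inter> p -` U" "\<forall>V\<in>\<V>. openin E V"
       "pairwise disjnt \<V>" "\<forall>V\<in>\<V>. homeomorphic_map (subtopology E V) (subtopology X U) p"
      using cov unfolding covering_map_def by meson
    have Usub: "U \<subseteq> topspace X"
      by (rule openin_subset[OF U(2)])
    have "homeomorphic_map (subtopology X U) (subtopology X (g ` U)) g"
      by (rule homeomorphic_map_subtopologies_alt[OF g])
         (use Usub ginj in \<open>auto simp: inj_on_def\<close>)
    then have "\<forall>V\<in>\<V>. homeomorphic_map (subtopology E V) (subtopology X (g ` U)) (g \<circ> p)"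
      using U(6) by (auto intro: homeomorphic_map_compose)
    moreover have "topspace E \<inter> (g \<circ> p) -` (g ` U) = topspace E \<inter> p -` U"
    proof (intro equalityI subsetI)
      fix z assume z: "z \<in> topspace E \<inter> (g \<circ> p) -` (g ` U)"
      then obtain u where u: "u \<in> U" "g (p z) = g u"
        by auto
      moreover have "p z \<in> topspace X"
        using p(2) z by blast
      ultimately have "p z = u"
        using ginj Usub by (metis inj_onD subset_iff)
      then show "z \<in> topspace E \<inter> p -` U"
        using z u by auto
    qed auto
    moreover have "openin X (g ` U)" "y \<in> g ` U"
      using U(1,2) y0(2) homeomorphic_map_openness_eq[OF g, of U] by blast+
    ultimately show "\<exists>U. y \<in> U \<and> openin X U \<and>
        (\<exists>\<V>. \<Union>\<V> = topspace E \<inter> (g \<circ> p) -` U \<and> (\<forall>V\<in>\<V>. openin E V) \<and> pairwise disjnt \<V> \<and>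
             (\<forall>V\<in>\<V>. homeomorphic_map (subtopology E V) (subtopology X U) (g \<circ> p)))"
      by (intro exI[of _ "g ` U"] conjI exI[of _ \<V>]) (simp_all add: U(3-5))
  qed
qed

text \<open>The universal property is applied to the competing covering \<open>g\<^sup>-\<^sup>1 \<circ> p\<close> on the same total space; a
  map over \<open>X\<close> from \<open>p\<close> to it is a lift of \<open>g\<close>.\<close>

lemma universal_covering_lift_continuous:
  assumes univ: "universal_covering E p X" and g: "homeomorphic_map X X g"
    and e: "e \<in> topspace E" "e' \<in> topspace E" "p e' = g (p e)"
  obtains f where "continuous_map E E f" "f e = e'" "\<And>z. z \<in> topspace E \<Longrightarrow> p (f z) = g (p z)"
proof -
  have cov: "covering_map E p X" and conn: "connected_space E"
    using univ path_connected_imp_connected_space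
    by (auto simp: universal_covering_def simply_connected_space_def)
  then have pX: "p z \<in> topspace X" if "z \<in> topspace E" for z
    using that by (auto simp: covering_map_def)
  obtain h where h: "homeomorphic_maps X X g h"
    using g homeomorphic_map_maps by blast
  then have hh: "homeomorphic_map X X h"
    using homeomorphic_maps_map by blast
  have gh: "g (h y) = y" "h (g y) = y" if "y \<in> topspace X" for y
    using h that by (auto simp: homeomorphic_maps_def)
  have "p e = (h \<circ> p) e'"
    using e gh pX by simp
  then have "\<exists>f. continuous_map E E f \<and> f e = e' \<and> (\<forall>z\<in>topspace E. (h \<circ> p) (f z) = p z)"
    using univ covering_map_compose_homeomorphism[OF cov hh] conn e(1,2)
    unfolding universal_covering_def by blast
  then obtain f where f: "continuous_map E E f" "f e = e'" "\<forall>z\<in>topspace E. h (p (f z)) = p z"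
    by auto
  have "p (f z) = g (p z)" if z: "z \<in> topspace E" for z
  proof -
    have "f z \<in> topspace E"
      using f(1) z by (auto simp: continuous_map_def)
    then show ?thesis
      using gh(1)[OF pX[of "f z"]] f(3) z by simp
  qed
  with f(1,2) that show ?thesis by blast
qed

text \<open>Lifts of \<open>g\<close> and of its inverse with matching base points are mutually inverse, since their
  composites lift the identity and fix a point. For \<open>g = id\<close> this says that deck transformations act
  transitively on the fibres.\<close>

lemma universal_covering_lift_homeomorphism:
  assumes univ: "universal_covering E p X" and g: "homeomorphic_map X X g"
    and e: "e \<in> topspace E" "e' \<in> topspace E" "p e' = g (p e)"
  obtains f f' where "homeomorphic_maps E E f f'" "f e = e'"
    "\<And>z. z \<in> topspace E \<Longrightarrow> p (f z) = g (p z)"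
proof -
  have cov: "covering_map E p X" and conn: "connected_space E"
    using univ path_connected_imp_connected_space
    by (auto simp: universal_covering_def simply_connected_space_def)
  then have pX: "p z \<in> topspace X" if "z \<in> topspace E" for z
    using that by (auto simp: covering_map_def)
  obtain h where h: "homeomorphic_maps X X g h"
    using g homeomorphic_map_maps by blast
  then have hh: "homeomorphic_map X X h"
    using homeomorphic_maps_map by blast
  have gh: "g (h y) = y" "h (g y) = y" if "y \<in> topspace X" for y
    using h that by (auto simp: homeomorphic_maps_def)
  from universal_covering_lift_continuous[OF univ g e]
  obtain f where f: "continuous_map E E f" "f e = e'" "\<And>z. z \<in> topspace E \<Longrightarrow> p (f z) = g (p z)" by blast
  from universal_covering_lift_continuous[OF univ hh e(2,1)] e gh pX
  obtain f' where f': "continuous_map E E f'" "f' e' = e" "\<And>z. z \<in> topspace E \<Longrightarrow> p (f' z) = h (p z)"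
    by (metis (no_types, lifting))
  have fE: "f z \<in> topspace E" "f' z \<in> topspace E" if "z \<in> topspace E" for z
    using f(1) f'(1) that by (auto simp: continuous_map_def)
  have "f' (f z) = z" if "z \<in> topspace E" for z
    using covering_lift_unique[OF cov conn continuous_map_compose[OF f(1) f'(1)] continuous_map_id, of e z]
      e(1,2) f(2,3) f'(2,3) fE gh pX that by simp
  moreover have "f (f' z) = z" if "z \<in> topspace E" for z
    using covering_lift_unique[OF cov conn continuous_map_compose[OF f'(1) f(1)] continuous_map_id, of e' z]
      e(1,2) f(2,3) f'(2,3) fE gh pX that by simp
  ultimately have "homeomorphic_maps E E f f'"
    using f(1) f'(1) by (auto simp: homeomorphic_maps_def)
  with f(2,3) that show ?thesis by blast
qed

section \<open>Integrals of one-cocycles along paths\<close>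

lemma standard_simplex_1_bounds:
  assumes "u \<in> standard_simplex 1"
  shows "u 0 = 1 - u 1" "0 \<le> u 1" "u 1 \<le> 1"
  using assms by (auto simp: standard_simplex_def)

lemma path_simplex_cong:
  assumes "\<And>t. 0 \<le> t \<Longrightarrow> t \<le> 1 \<Longrightarrow> \<gamma> t = \<eta> t"
  shows "path_simplex \<gamma> = path_simplex \<eta>"
  unfolding path_simplex_def by (rule restrict_ext) (use assms standard_simplex_1_bounds in auto)

lemma simplex_map_path_simplex: "simplex_map 1 f (path_simplex \<gamma>) = path_simplex (f \<circ> \<gamma>)"
  unfolding path_simplex_def simplex_map_def by (rule restrict_ext) auto

lemma singular_simplex_path_simplex:
  assumes "pathin X \<gamma>"
  shows "singular_simplex 1 X (path_simplex \<gamma>)"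
proof -
  let ?S = "subtopology (powertop_real UNIV) (standard_simplex 1)"
  have "continuous_map ?S euclideanreal (\<lambda>u. u 1)"
    by (rule continuous_map_from_subtopology) (rule continuous_map_product_projection, simp)
  then have "continuous_map ?S (top_of_set {0..1}) (\<lambda>u. u 1)"
    using standard_simplex_1_bounds by (auto simp: continuous_map_in_subtopology)
  from continuous_map_compose[OF this assms[unfolded pathin_def]]
  have "continuous_map ?S X (path_simplex \<gamma>)"
    by (rule continuous_map_eq) (auto simp: path_simplex_def)
  then show ?thesis
    by (simp add: singular_simplex_def path_simplex_def)
qed

lemma singular_face_path_simplex:
  "singular_face 1 0 (path_simplex \<gamma>) = point_simplex (\<gamma> 1)"
  "singular_face 1 1 (path_simplex \<gamma>) = point_simplex (\<gamma> 0)"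
proof -
  have face: "simplical_face k u \<in> standard_simplex 1"
    if "u \<in> standard_simplex 0" "k \<le> 1" for u k
    using simplical_face_in_standard_simplex[of 1 k u] that by simp
  have u0: "u 0 = 1" if "u \<in> standard_simplex 0" for u
    using that by (simp add: standard_simplex_0)
  show "singular_face 1 0 (path_simplex \<gamma>) = point_simplex (\<gamma> 1)"
    unfolding singular_face_def path_simplex_def point_simplex_def diff_self_eq_0 One_nat_def[symmetric]
  proof (rule restrict_ext)
    fix u :: "nat \<Rightarrow> real" assume "u \<in> standard_simplex 0"
    with face[OF this, of 0] show "((\<lambda>u\<in>standard_simplex 1. \<gamma> (u 1)) \<circ> simplical_face 0) u = \<gamma> 1"
      by (simp add: simplical_face_def u0)
  qed
  show "singular_face 1 1 (path_simplex \<gamma>) = point_simplex (\<gamma> 0)"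
    unfolding singular_face_def path_simplex_def point_simplex_def diff_self_eq_0 One_nat_def[symmetric]
    by (rule restrict_ext) (use face[of _ 1] in \<open>simp add: simplical_face_def\<close>)
qed

lemma cobdry_0_path_simplex:
  assumes "pathin X \<gamma>"
  shows "cobdry 0 X \<kappa> (path_simplex \<gamma>) = \<kappa> (point_simplex (\<gamma> 1)) - \<kappa> (point_simplex (\<gamma> 0))"
  using singular_simplex_path_simplex[OF assms] singular_face_path_simplex[of \<gamma>]
  by (simp add: cobdry_def)

text \<open>The last two barycentric coordinates identify the standard 2-simplex with this triangle, whose
  vertices \<open>(0,0)\<close>, \<open>(1,0)\<close>, \<open>(0,1)\<close> are taken in this order.\<close>

definition triangle :: "(real \<times> real) set" where
  "triangle = {(a, b). 0 \<le> a \<and> 0 \<le> b \<and> a + b \<le> 1}"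

definition triangle_simplex :: "(real \<times> real \<Rightarrow> 'a) \<Rightarrow> (nat \<Rightarrow> real) \<Rightarrow> 'a" where
  "triangle_simplex w = restrict (\<lambda>u. w (u 1, u 2)) (standard_simplex 2)"

lemma singular_simplex_triangle_simplex:
  assumes "continuous_map (top_of_set triangle) X w"
  shows "singular_simplex 2 X (triangle_simplex w)"
proof -
  let ?S = "subtopology (powertop_real UNIV) (standard_simplex 2)"
  have "continuous_map ?S euclideanreal (\<lambda>u. u i)" for i
    by (rule continuous_map_from_subtopology) (rule continuous_map_product_projection, simp)
  then have "continuous_map ?S (prod_topology euclideanreal euclideanreal) (\<lambda>u. (u 1, u 2))"
    by (intro continuous_map_pairedI)
  moreover have "(u 1, u 2) \<in> triangle" if "u \<in> standard_simplex 2" for u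
  proof -
    have "u 0 + u 1 + u 2 = 1" "\<And>i. 0 \<le> u i"
      using that by (auto simp: standard_simplex_def numeral_2_eq_2)
    from this(1) this(2)[of 0] this(2)[of 1] this(2)[of 2] show ?thesis
      by (simp add: triangle_def)
  qed
  ultimately have "continuous_map ?S (top_of_set triangle) (\<lambda>u. (u 1, u 2))"
    by (auto simp: continuous_map_in_subtopology)
  from continuous_map_compose[OF this assms]
  have "continuous_map ?S X (triangle_simplex w)"
    by (rule continuous_map_eq) (auto simp: triangle_simplex_def)
  then show ?thesis
    by (simp add: singular_simplex_def triangle_simplex_def)
qed

lemma singular_face_triangle_simplex:
  "singular_face 2 0 (triangle_simplex w) = path_simplex (\<lambda>t. w (1 - t, t))"
  "singular_face 2 1 (triangle_simplex w) = path_simplex (\<lambda>t. w (0, t))"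
  "singular_face 2 2 (triangle_simplex w) = path_simplex (\<lambda>t. w (t, 0))"
proof -
  have two: "2 - Suc 0 = 1"
    by simp
  have face: "simplical_face k u \<in> standard_simplex 2"
    if "u \<in> standard_simplex 1" "k \<le> 2" for u k
    using simplical_face_in_standard_simplex[of 2 k u] that by simp
  show "singular_face 2 0 (triangle_simplex w) = path_simplex (\<lambda>t. w (1 - t, t))"
    unfolding singular_face_def path_simplex_def triangle_simplex_def two
    by (rule restrict_ext)
      (use face[of _ 0] standard_simplex_1_bounds in \<open>simp add: simplical_face_def\<close>)
  show "singular_face 2 1 (triangle_simplex w) = path_simplex (\<lambda>t. w (0, t))"
    unfolding singular_face_def path_simplex_def triangle_simplex_def two
    by (rule restrict_ext)
      (use face[of _ 1] in \<open>simp add: simplical_face_def\<close>)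
  show "singular_face 2 2 (triangle_simplex w) = path_simplex (\<lambda>t. w (t, 0))"
    unfolding singular_face_def path_simplex_def triangle_simplex_def two
    by (rule restrict_ext)
      (use face[of _ 2] in \<open>simp add: simplical_face_def\<close>)
qed

text \<open>The cocycle condition on a triangle: the integral along the edge from the first to the last
  vertex is the sum of the integrals along the other two edges. All the rules for path integrals
  below are instances for suitable maps from the triangle.\<close>

lemma cocycle_triangle:
  fixes \<alpha> :: "('a, 'c::ab_group_add) cochain"
  assumes \<alpha>: "\<alpha> \<in> carrier (cocycle_group 1 X)" and w: "continuous_map (top_of_set triangle) X w"
  shows "\<alpha> (path_simplex (\<lambda>t. w (0, t)))
       = \<alpha> (path_simplex (\<lambda>t. w (t, 0))) + \<alpha> (path_simplex (\<lambda>t. w (1 - t, t)))"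
proof -
  have "cobdry 1 X \<alpha> (triangle_simplex w) = 0"
    using \<alpha> by (simp add: cocycle_group_def)
  moreover have "Suc 1 = (2::nat)" "{..2::nat} = {0, 1, 2}"
    by auto
  ultimately have "\<alpha> (singular_face 2 0 (triangle_simplex w)) - \<alpha> (singular_face 2 1 (triangle_simplex w))
      + \<alpha> (singular_face 2 2 (triangle_simplex w)) = 0"
    using singular_simplex_triangle_simplex[OF w]
    by (simp add: cobdry_def algebra_simps del: One_nat_def)
  then show ?thesis
    unfolding singular_face_triangle_simplex by (simp add: algebra_simps)
qed

lemma cocycle_constant_path:
  fixes \<alpha> :: "('a, 'c::ab_group_add) cochain"
  assumes \<alpha>: "\<alpha> \<in> carrier (cocycle_group 1 X)" and a: "a \<in> topspace X"
  shows "\<alpha> (path_simplex (\<lambda>t. a)) = 0"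
  using cocycle_triangle[OF \<alpha>, of "\<lambda>_. a"] a by simp

lemma cocycle_reverse_path:
  fixes \<alpha> :: "('a, 'c::ab_group_add) cochain"
  assumes \<alpha>: "\<alpha> \<in> carrier (cocycle_group 1 X)" and \<gamma>: "pathin X \<gamma>"
  shows "\<alpha> (path_simplex (\<lambda>t. \<gamma> (1 - t))) = - \<alpha> (path_simplex \<gamma>)"
proof -
  have "continuous_map (top_of_set triangle) (top_of_set {0..1}) fst"
    by (auto simp: continuous_map_in_subtopology triangle_def intro!: continuous_intros)
  from continuous_map_compose[OF this \<gamma>[unfolded pathin_def]]
  have "continuous_map (top_of_set triangle) X (\<gamma> \<circ> fst)" .
  moreover have "\<gamma> 0 \<in> topspace X"
    using \<gamma> by (auto simp: pathin_def continuous_map_def)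
  ultimately show ?thesis
    using cocycle_triangle[OF \<alpha>, of "\<gamma> \<circ> fst"] cocycle_constant_path[OF \<alpha>, of "\<gamma> 0"]
    by (simp add: eq_neg_iff_add_eq_0 add.commute)
qed

definition path_join :: "(real \<Rightarrow> 'a) \<Rightarrow> (real \<Rightarrow> 'a) \<Rightarrow> real \<Rightarrow> 'a" where
  "path_join \<gamma> \<eta> t = (if t \<le> 1/2 then \<gamma> (2 * t) else \<eta> (2 * t - 1))"

lemma pathin_path_join:
  assumes "pathin X \<gamma>" "pathin X \<eta>" "\<gamma> 1 = \<eta> 0"
  shows "pathin X (path_join \<gamma> \<eta>)"
  unfolding pathin_def path_join_def
proof (rule continuous_map_cases_le)
  have "continuous_map (subtopology (top_of_set {0..1}) {x \<in> topspace (top_of_set {0..1}). x \<le> 1/2})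
      (top_of_set {0..1}) (\<lambda>t. 2 * t :: real)"
    by (auto simp: continuous_map_in_subtopology subtopology_subtopology intro!: continuous_intros)
  from continuous_map_compose[OF this assms(1)[unfolded pathin_def]]
  show "continuous_map (subtopology (top_of_set {0..1}) {x \<in> topspace (top_of_set {0..1}). x \<le> 1/2})
      X (\<lambda>t. \<gamma> (2 * t))"
    by (simp add: o_def)
  have "continuous_map (subtopology (top_of_set {0..1}) {x \<in> topspace (top_of_set {0..1}). 1/2 \<le> x})
      (top_of_set {0..1}) (\<lambda>t. 2 * t - 1 :: real)"
    by (auto simp: continuous_map_in_subtopology subtopology_subtopology intro!: continuous_intros)
  from continuous_map_compose[OF this assms(2)[unfolded pathin_def]]
  show "continuous_map (subtopology (top_of_set {0..1}) {x \<in> topspace (top_of_set {0..1}). 1/2 \<le> x})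
      X (\<lambda>t. \<eta> (2 * t - 1))"
    by (simp add: o_def)
  fix t :: real assume "t = 1/2"
  then have "2 * t = 1"
    by simp
  with assms(3) show "\<gamma> (2 * t) = \<eta> (2 * t - 1)"
    by (metis diff_self)
qed (auto simp: continuous_map_from_subtopology)

lemma cocycle_path_join:
  fixes \<alpha> :: "('a, 'c::ab_group_add) cochain"
  assumes \<alpha>: "\<alpha> \<in> carrier (cocycle_group 1 X)"
    and "pathin X \<gamma>" "pathin X \<eta>" and meet: "\<gamma> 1 = \<eta> 0"
  shows "\<alpha> (path_simplex (path_join \<gamma> \<eta>)) = \<alpha> (path_simplex \<gamma>) + \<alpha> (path_simplex \<eta>)"
proof -
  \<comment> \<open>the affine map sending the three vertices to the times 0, 1/2 and 1\<close>
  have "continuous_map (top_of_set triangle) (top_of_set {0..1}) (\<lambda>u. fst u / 2 + snd u)"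
    by (auto simp: continuous_map_in_subtopology triangle_def intro!: continuous_intros)
  from continuous_map_compose[OF this pathin_path_join[OF assms(2-4), unfolded pathin_def]]
  have w: "continuous_map (top_of_set triangle) X (path_join \<gamma> \<eta> \<circ> (\<lambda>u. fst u / 2 + snd u))" .
  have "path_simplex (\<lambda>t. path_join \<gamma> \<eta> (t / 2)) = path_simplex \<gamma>"
    by (rule path_simplex_cong) (simp add: path_join_def)
  moreover have "path_simplex (\<lambda>t. path_join \<gamma> \<eta> ((1 - t) / 2 + t)) = path_simplex \<eta>"
  proof (rule path_simplex_cong)
    fix t :: real assume t: "0 \<le> t" "t \<le> 1"
    have *: "2 * ((1 - t) / 2 + t) = 1 + t"
      by (simp add: field_simps)
    show "path_join \<gamma> \<eta> ((1 - t) / 2 + t) = \<eta> t"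
    proof (cases "t = 0")
      case True
      then show ?thesis using meet by (simp add: path_join_def)
    next
      case False
      then have "\<not> (1 - t) / 2 + t \<le> 1 / 2"
        using t by (simp add: field_simps)
      then show ?thesis
        unfolding path_join_def * by simp
    qed
  qed
  ultimately show ?thesis
    using cocycle_triangle[OF \<alpha> w] by simp
qed

text \<open>The square on which the homotopy lives is cut along its diagonal. In the lower triangle two sides
  are constant, so the diagonal has integral zero; in the upper triangle the sides are the loop and a
  constant path, so the loop has the same integral as the diagonal.\<close>

lemma cocycle_nullhomotopic_loop:
  fixes \<alpha> :: "('a, 'c::ab_group_add) cochain"
  assumes \<alpha>: "\<alpha> \<in> carrier (cocycle_group 1 X)" and p: "continuous_map E X p"
    and hom: "homotopic_with (\<lambda>\<eta>. \<eta> 0 = a \<and> \<eta> 1 = a) (top_of_set {0..1}) E \<gamma> (\<lambda>t. a)"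
  shows "\<alpha> (path_simplex (p \<circ> \<gamma>)) = 0"
proof -
  obtain h :: "real \<times> real \<Rightarrow> _" where h: "continuous_map (prod_topology (top_of_set {0..1}) (top_of_set {0..1})) E h"
      "\<And>t. h (0, t) = \<gamma> t" "\<And>t. h (1, t) = a" "\<And>s. s \<in> {0..1} \<Longrightarrow> h (s, 0) = a \<and> h (s, 1) = a"
    using hom unfolding homotopic_with_def by blast
  have "h (0, 0) \<in> topspace E"
    using h(1) by (auto simp: continuous_map_def Pi_iff)
  then have pa: "p a \<in> topspace X"
    using h(4)[of 0] p by (auto simp: continuous_map_def)
  note const = cocycle_constant_path[OF \<alpha> pa]
  have side: "path_simplex (\<lambda>t. p (h (t, 0))) = path_simplex (\<lambda>t. p a)"
      "path_simplex (\<lambda>t. p (h (t, 1))) = path_simplex (\<lambda>t. p a)"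
    by (rule path_simplex_cong; use h(4) in simp)+
  have "continuous_map (top_of_set triangle) (prod_topology (top_of_set {0..1}) (top_of_set {0..1}))
      (\<lambda>u. (snd u, fst u + snd u))"
    by (rule continuous_map_pairedI)
      (auto simp: continuous_map_in_subtopology triangle_def intro!: continuous_intros)
  from continuous_map_compose[OF continuous_map_compose[OF this h(1)] p]
  have upper: "continuous_map (top_of_set triangle) X (p \<circ> (h \<circ> (\<lambda>u. (snd u, fst u + snd u))))" .
  have "continuous_map (top_of_set triangle) (prod_topology (top_of_set {0..1}) (top_of_set {0..1}))
      (\<lambda>u. (fst u + snd u, snd u))"
    by (rule continuous_map_pairedI)
      (auto simp: continuous_map_in_subtopology triangle_def intro!: continuous_intros)
  from continuous_map_compose[OF continuous_map_compose[OF this h(1)] p]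
  have lower: "continuous_map (top_of_set triangle) X (p \<circ> (h \<circ> (\<lambda>u. (fst u + snd u, snd u))))" .
  have "\<alpha> (path_simplex (\<lambda>t. p (h (t, t)))) = 0"
    using cocycle_triangle[OF \<alpha> lower] const h(3) side by simp
  moreover have "\<alpha> (path_simplex (\<lambda>t. p (h (t, t)))) = \<alpha> (path_simplex (\<lambda>t. p (h (0, t))))"
    using cocycle_triangle[OF \<alpha> upper] const side by simp
  ultimately show ?thesis
    by (simp add: h(2) o_def)
qed

text \<open>A pulled back cocycle integrates to zero over every loop in \<open>E\<close>, hence equally over paths with the
  same ends; the primitive is the integral along any path from a fixed point.\<close>

lemma simply_connected_cocycle_primitive:
  fixes \<alpha> :: "('a, 'c::ab_group_add) cochain"
  assumes \<alpha>: "\<alpha> \<in> carrier (cocycle_group 1 X)" and p: "continuous_map E X p"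
    and E: "simply_connected_space E"
  obtains F where "\<And>\<gamma>. pathin E \<gamma> \<Longrightarrow> \<alpha> (path_simplex (p \<circ> \<gamma>)) = F (\<gamma> 1) - F (\<gamma> 0)"
proof (cases "topspace E = {}")
  case True
  then have "\<not> pathin E \<gamma>" for \<gamma>
    using path_start_in_topspace by fastforce
  then show ?thesis using that by blast
next
  case False
  then obtain b where b: "b \<in> topspace E"
    by blast
  have pp: "pathin X (p \<circ> \<gamma>)" if "pathin E \<gamma>" for \<gamma>
    using that p by (rule pathin_compose)
  have loop: "\<alpha> (path_simplex (p \<circ> \<gamma>)) = 0" if "pathin E \<gamma>" "\<gamma> 1 = \<gamma> 0" for \<gamma>
    using cocycle_nullhomotopic_loop[OF \<alpha> p] E that unfolding simply_connected_space_def by blast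
  have indep: "\<alpha> (path_simplex (p \<circ> \<gamma>)) = \<alpha> (path_simplex (p \<circ> \<eta>))"
    if "pathin E \<gamma>" "pathin E \<eta>" "\<gamma> 0 = \<eta> 0" "\<gamma> 1 = \<eta> 1" for \<gamma> \<eta>
  proof -
    let ?r = "\<lambda>t. \<eta> (1 - t)"
    have "continuous_map (top_of_set {0..1}) (top_of_set {0..1}) (\<lambda>t. 1 - t :: real)"
      by (auto simp: continuous_map_in_subtopology intro!: continuous_intros)
    from continuous_map_compose[OF this that(2)[unfolded pathin_def]]
    have r: "pathin E ?r"
      by (simp add: pathin_def o_def)
    have "pathin E (path_join \<gamma> ?r)"
      using that r by (intro pathin_path_join) auto
    then have "\<alpha> (path_simplex (p \<circ> path_join \<gamma> ?r)) = 0"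
      by (rule loop) (use that in \<open>simp add: path_join_def\<close>)
    moreover have "p \<circ> path_join \<gamma> ?r = path_join (p \<circ> \<gamma>) (\<lambda>t. (p \<circ> \<eta>) (1 - t))"
      by (auto simp: path_join_def)
    moreover have "pathin X (\<lambda>t. (p \<circ> \<eta>) (1 - t))"
      using pp[OF r] by (simp add: o_def)
    ultimately show ?thesis
      using cocycle_path_join[OF \<alpha> pp[OF that(1)], of "\<lambda>t. (p \<circ> \<eta>) (1 - t)"]
        cocycle_reverse_path[OF \<alpha> pp[OF that(2)]] that by simp
  qed
  have "\<exists>\<gamma>. pathin E \<gamma> \<and> \<gamma> 0 = b \<and> \<gamma> 1 = e" if "e \<in> topspace E" for e
    using E b that unfolding simply_connected_space_def path_connected_space_def by blast
  then obtain c where c: "\<And>e. e \<in> topspace E \<Longrightarrow> pathin E (c e) \<and> c e 0 = b \<and> c e 1 = e"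
    by metis
  have "\<alpha> (path_simplex (p \<circ> \<gamma>)) = \<alpha> (path_simplex (p \<circ> c (\<gamma> 1))) - \<alpha> (path_simplex (p \<circ> c (\<gamma> 0)))"
    if \<gamma>: "pathin E \<gamma>" for \<gamma>
  proof -
    have ends: "\<gamma> 0 \<in> topspace E" "\<gamma> 1 \<in> topspace E"
      using \<gamma> by (auto simp: pathin_def continuous_map_def)
    have "pathin E (path_join (c (\<gamma> 0)) \<gamma>)"
      using c[OF ends(1)] \<gamma> by (intro pathin_path_join) auto
    then have "\<alpha> (path_simplex (p \<circ> path_join (c (\<gamma> 0)) \<gamma>)) = \<alpha> (path_simplex (p \<circ> c (\<gamma> 1)))"
      by (rule indep) (use c[OF ends(1)] c[OF ends(2)] in \<open>auto simp: path_join_def\<close>)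
    moreover have "p \<circ> path_join (c (\<gamma> 0)) \<gamma> = path_join (p \<circ> c (\<gamma> 0)) (p \<circ> \<gamma>)"
      by (auto simp: path_join_def)
    ultimately show ?thesis
      using cocycle_path_join[OF \<alpha> pp[of "c (\<gamma> 0)"] pp[OF \<gamma>]] c[OF ends(1)]
      by (simp add: eq_diff_eq add.commute)
  qed
  then show ?thesis by (rule that[of "\<lambda>e. \<alpha> (path_simplex (p \<circ> c e))"])
qed

section \<open>The flat circle bundle in coordinates\<close>

text \<open>Along a path from \<open>z\<close> to \<open>e\<close>, the increment of \<open>F \<circ> f\<close> is the integral of \<open>g\<^sup>*\<alpha>\<close> over the projected
  path and the increment of \<open>F\<close> is that of \<open>\<alpha>\<close>, so they differ by the increment of the potential \<open>K\<close>.
  This is the one computation that links the bundle to the cochain \<open>K\<close>.\<close>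

lemma path_increment_lift_constant:
  fixes \<alpha> :: "('a, 'c::ab_group_add) cochain"
  assumes F: "\<And>\<gamma>. pathin E \<gamma> \<Longrightarrow> \<alpha> (path_simplex (p \<circ> \<gamma>)) = F (\<gamma> 1) - F (\<gamma> 0)"
    and K: "\<And>\<gamma>. pathin X \<gamma> \<Longrightarrow>
      \<alpha> (path_simplex (g \<circ> \<gamma>)) - \<alpha> (path_simplex \<gamma>) = K (\<gamma> 1) - K (\<gamma> 0)"
    and p: "continuous_map E X p" and E: "path_connected_space E"
    and f: "continuous_map E E f" "\<And>z. z \<in> topspace E \<Longrightarrow> p (f z) = g (p z)"
    and ez: "e \<in> topspace E" "z \<in> topspace E"
  shows "F (f e) - F e - K (p e) = F (f z) - F z - K (p z)"
proof -
  obtain \<gamma> where \<gamma>: "pathin E \<gamma>" "\<gamma> 0 = z" "\<gamma> 1 = e"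
    using E ez unfolding path_connected_space_def by blast
  have "path_simplex (p \<circ> (f \<circ> \<gamma>)) = path_simplex (g \<circ> (p \<circ> \<gamma>))"
    using path_image_subset_topspace[OF \<gamma>(1)] by (intro path_simplex_cong) (auto simp: Pi_iff f(2))
  with F[OF pathin_compose[OF \<gamma>(1) f(1)]] F[OF \<gamma>(1)] K[OF pathin_compose[OF \<gamma>(1) p]]
  have "(F (f e) - F (f z)) - (F e - F z) = K (p e) - K (p z)"
    by (simp add: \<gamma>(2,3))
  then show ?thesis
    by (simp add: algebra_simps)
qed

text \<open>A primitive \<open>F\<close> of \<open>p\<^sup>*\<alpha>\<close> makes \<open>s + F e\<close> a well-defined function of the bundle point \<open>[e, s]\<close>: the
  holonomy of a loop \<open>p \<circ> \<gamma>\<close> is exactly the increment of \<open>F\<close> along \<open>\<gamma>\<close>. Together with the projection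
  this phase gives global coordinates, a bijection from the flat bundle to \<open>X \<times> S\<^sup>1\<close> that is equivariant
  but in general not continuous. All bundle computations are made in these coordinates.\<close>

locale flat_bundle_coordinates =
  fixes E :: "'b topology" and p :: "'b \<Rightarrow> 'a" and X :: "'a topology"
    and \<rho> :: "('a, circle) cochain set" and \<alpha> :: "('a, circle) cochain" and F :: "'b \<Rightarrow> circle"
  assumes univ: "universal_covering E p X"
    and primitive: "\<And>\<gamma>. pathin E \<gamma> \<Longrightarrow> \<alpha> (path_simplex (p \<circ> \<gamma>)) = F (\<gamma> 1) - F (\<gamma> 0)"
    and loop_value: "\<And>\<gamma>. pathin X \<gamma> \<Longrightarrow> \<gamma> 1 = \<gamma> 0 \<Longrightarrow> loop_value \<rho> \<gamma> = \<alpha> (path_simplex \<gamma>)"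
begin

abbreviation P where "P \<equiv> flat_bundle E p \<rho>"

text \<open>The bundle point \<open>[e, s]\<close>.\<close>

definition pt :: "'b \<Rightarrow> circle \<Rightarrow> ('b \<times> circle) set" where
  "pt e s = holonomy_rel E p \<rho> `` {(e, s)}"

definition phase :: "('b \<times> circle) set \<Rightarrow> circle" where
  "phase u = the_elem ((\<lambda>(e, s). s + F e) ` u)"

lemma cov: "covering_map E p X"
  and path_connected: "path_connected_space E"
  and connected: "connected_space E"
  using univ path_connected_imp_connected_space
  by (auto simp: universal_covering_def simply_connected_space_def)

lemma p_continuous: "continuous_map E X p" and p_surj: "p ` topspace E = topspace X"
  using cov by (auto simp: covering_map_def)

lemma p_in: "e \<in> topspace E \<Longrightarrow> p e \<in> topspace X"
  using p_surj by blast

lemma deck_transformation_shift: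
  assumes "deck_transformation E p \<phi>" "e \<in> topspace E" "z \<in> topspace E"
  shows "F (\<phi> e) - F e = F (\<phi> z) - F z"
  using path_increment_lift_constant[where \<alpha> = \<alpha> and p = p and F = F and X = X and g = id and K = "\<lambda>_. 0", OF primitive _ p_continuous path_connected,
      of \<phi> e z] assms
  by (simp add: deck_transformation_def homeomorphic_imp_continuous_map)

lemma deck_transformation_exists:
  assumes "e \<in> topspace E" "z \<in> topspace E" "p e = p z"
  obtains \<phi> where "deck_transformation E p \<phi>" "\<phi> z = e"
proof -
  have "homeomorphic_map X X id"
    by simp
  from universal_covering_lift_homeomorphism[OF univ this assms(2,1)] assms(3)
  obtain f f' where f: "homeomorphic_maps E E f f'" "f z = e"
    "\<And>z. z \<in> topspace E \<Longrightarrow> p (f z) = id (p z)" by auto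
  then have "deck_transformation E p f"
    using homeomorphic_maps_map[of E E f f'] by (simp add: deck_transformation_def)
  with f(2) show ?thesis by (rule that[rotated])
qed

text \<open>Two points are identified exactly when they have the same projection and the same phase. One
  inclusion computes the holonomy from \<open>F\<close>; the other needs a deck transformation between any two
  points of a fibre. In particular the relation is an equivalence.\<close>

lemma holonomy_rel_eq:
  "holonomy_rel E p \<rho> = {((e, s), (z, t)).
     e \<in> topspace E \<and> z \<in> topspace E \<and> p e = p z \<and> s + F e = t + F z}"
proof (intro equalityI subsetI)
  fix a assume "a \<in> holonomy_rel E p \<rho>"
  then obtain \<phi> \<gamma> z s where a: "a = ((\<phi> z, s), (z, s + loop_value \<rho> (p \<circ> \<gamma>)))"
      "deck_transformation E p \<phi>" "z \<in> topspace E" "pathin E \<gamma>" "\<gamma> 0 = z" "\<gamma> 1 = \<phi> z"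
    unfolding holonomy_rel_def by blast
  have "\<phi> z \<in> topspace E"
    using a path_finish_in_topspace by metis
  moreover have "p (\<phi> z) = p z"
    using a by (simp add: deck_transformation_def)
  moreover have "loop_value \<rho> (p \<circ> \<gamma>) = F (\<phi> z) - F z"
    using loop_value[OF pathin_compose[OF a(4) p_continuous]] primitive[OF a(4)] a(5,6) calculation(2)
    by simp
  ultimately show "a \<in> {((e, s), (z, t)).
     e \<in> topspace E \<and> z \<in> topspace E \<and> p e = p z \<and> s + F e = t + F z}"
    using a(1,3) by simp
next
  fix a assume "a \<in> {((e, s), (z, t)).
     e \<in> topspace E \<and> z \<in> topspace E \<and> p e = p z \<and> s + F e = t + F z}"
  then obtain e s z t where a: "a = ((e, s), (z, t))" "e \<in> topspace E" "z \<in> topspace E"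
      "p e = p z" "s + F e = t + F z"
    by auto
  obtain \<phi> where \<phi>: "deck_transformation E p \<phi>" "\<phi> z = e"
    using deck_transformation_exists[OF a(2-4)] .
  obtain \<gamma> where \<gamma>: "pathin E \<gamma>" "\<gamma> 0 = z" "\<gamma> 1 = e"
    using path_connected a unfolding path_connected_space_def by blast
  have "loop_value \<rho> (p \<circ> \<gamma>) = F e - F z"
    using loop_value[OF pathin_compose[OF \<gamma>(1) p_continuous]] primitive[OF \<gamma>(1)] \<gamma>(2,3) a(4)
    by simp
  then have "t = s + loop_value \<rho> (p \<circ> \<gamma>)"
    using a(5) by (metis add_diff_cancel_right' add_diff_eq)
  with a \<phi> \<gamma> show "a \<in> holonomy_rel E p \<rho>"
    unfolding holonomy_rel_def by auto
qed

lemma pt_eq_Collect: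
  "e \<in> topspace E \<Longrightarrow> pt e s = {(z, t). z \<in> topspace E \<and> p z = p e \<and> t + F z = s + F e}"
  unfolding pt_def holonomy_rel_eq by auto

lemma pt_mem: "e \<in> topspace E \<Longrightarrow> (e, s) \<in> pt e s"
  by (simp add: pt_eq_Collect)

lemma bundle_proj_pt: "e \<in> topspace E \<Longrightarrow> bundle_proj p (pt e s) = p e"
proof -
  assume e: "e \<in> topspace E"
  have "(p \<circ> fst) ` pt e s = {p e}"
    using pt_mem[OF e, of s] by (auto simp: pt_eq_Collect[OF e] intro!: rev_image_eqI)
  then show ?thesis by (simp add: bundle_proj_def)
qed

lemma phase_pt: "e \<in> topspace E \<Longrightarrow> phase (pt e s) = s + F e"
proof -
  assume e: "e \<in> topspace E"
  have "(\<lambda>(e, s). s + F e) ` pt e s = {s + F e}"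
    using pt_mem[OF e, of s] by (auto simp: pt_eq_Collect[OF e] intro!: rev_image_eqI)
  then show ?thesis by (simp add: phase_def)
qed

lemma pt_eq_iff:
  assumes "e \<in> topspace E" "z \<in> topspace E"
  shows "pt e s = pt z t \<longleftrightarrow> p e = p z \<and> s + F e = t + F z"
proof
  assume "pt e s = pt z t"
  with assms show "p e = p z \<and> s + F e = t + F z"
    by (metis bundle_proj_pt phase_pt)
next
  assume "p e = p z \<and> s + F e = t + F z"
  with assms show "pt e s = pt z t"
    by (simp add: pt_eq_Collect)
qed

lemma principal_action_pt: "e \<in> topspace E \<Longrightarrow> principal_action a (pt e s) = pt e (s + a)"
proof -
  assume e: "e \<in> topspace E"
  have shift: "t + F z = s + F e \<longleftrightarrow> (t + a) + F z = (s + a) + F e" for z t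
    by (simp add: add.commute add.left_commute)
  show ?thesis
    unfolding principal_action_def pt_eq_Collect[OF e]
  proof (intro equalityI subsetI)
    fix w assume "w \<in> {(z, t). z \<in> topspace E \<and> p z = p e \<and> t + F z = (s + a) + F e}"
    then obtain z t where w: "w = (z, (t - a) + a)" "z \<in> topspace E" "p z = p e" "(t - a + a) + F z = (s + a) + F e"
      by auto
    with shift[of "t - a" z] show "w \<in> (\<lambda>(z, s). (z, s + a)) ` {(z, t). z \<in> topspace E \<and> p z = p e \<and> t + F z = s + F e}"
      by (intro rev_image_eqI[of "(z, t - a)"]) auto
  next
    fix w assume "w \<in> (\<lambda>(z, s). (z, s + a)) ` {(z, t). z \<in> topspace E \<and> p z = p e \<and> t + F z = s + F e}"
    with shift show "w \<in> {(z, t). z \<in> topspace E \<and> p z = p e \<and> t + F z = (s + a) + F e}"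
      by auto
  qed
qed

lemma topspace_P: "topspace P = {pt e s | e s. e \<in> topspace E}"
proof -
  let ?T = "prod_topology E (discrete_topology UNIV :: circle topology)"
  have quot: "topspace ?T // holonomy_rel E p \<rho> = {pt e s | e s. e \<in> topspace E}"
    by (auto simp: quotient_def pt_def)
  have "{x \<in> topspace ?T. holonomy_rel E p \<rho> `` {x} \<in> topspace ?T // holonomy_rel E p \<rho>} = topspace ?T"
    by (auto simp: quotient_def)
  then have "openin P (topspace ?T // holonomy_rel E p \<rho>)"
    unfolding flat_bundle_def openin_quotient_topology by (metis openin_topspace order_refl)
  moreover have "topspace P \<subseteq> topspace ?T // holonomy_rel E p \<rho>"
    using openin_topspace[of P] unfolding flat_bundle_def openin_quotient_topology by blast
  ultimately show ?thesis
    unfolding quot[symmetric] by (simp add: openin_subset subset_antisym)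
qed

lemma pt_in_P: "e \<in> topspace E \<Longrightarrow> pt e s \<in> topspace P"
  unfolding topspace_P by blast

lemma P_cases:
  assumes "u \<in> topspace P"
  obtains e s where "e \<in> topspace E" "u = pt e s"
  using assms unfolding topspace_P by blast

lemma P_eqI:
  assumes "u \<in> topspace P" "v \<in> topspace P" "bundle_proj p u = bundle_proj p v" "phase u = phase v"
  shows "u = v"
  using assms by (elim P_cases) (simp add: pt_eq_iff bundle_proj_pt phase_pt)

lemma bundle_proj_in: "u \<in> topspace P \<Longrightarrow> bundle_proj p u \<in> topspace X"
  by (elim P_cases) (simp add: bundle_proj_pt p_in)

lemma principal_action_coordinates:
  assumes "u \<in> topspace P"
  shows "principal_action a u \<in> topspace P" "bundle_proj p (principal_action a u) = bundle_proj p u"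
    "phase (principal_action a u) = phase u + a"
  using assms by (auto elim!: P_cases simp: principal_action_pt pt_in_P bundle_proj_pt phase_pt algebra_simps)

lemma quotient_map_pt:
  "quotient_map (prod_topology E (discrete_topology UNIV)) P (\<lambda>(e, s). pt e s)"
proof -
  have "{x \<in> topspace E \<times> UNIV. (case x of (e, s) \<Rightarrow> pt e s) \<in> U} =
      {x \<in> topspace E \<times> UNIV. holonomy_rel E p \<rho> `` {x} \<in> U}" for U
    by (auto simp: pt_def)
  moreover have "topspace P = (topspace E \<times> UNIV) // holonomy_rel E p \<rho>"
    unfolding topspace_P by (auto simp: quotient_def pt_def)
  moreover have "(\<lambda>(e, s). pt e s) ` (topspace E \<times> UNIV) = topspace P"
    unfolding topspace_P by auto
  ultimately show ?thesis
    unfolding quotient_map_def by (simp add: flat_bundle_def openin_quotient_topology)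
qed

text \<open>Horizontal sheets are open. This is where \<open>F (\<phi> e) - F e\<close> being constant in \<open>e\<close> is used: near any
  preimage \<open>(e, s)\<close>, one deck transformation moves all nearby points with the same second coordinate
  \<open>s\<close> into the given sheet.\<close>

lemma openin_slice:
  assumes V: "openin E V"
  shows "openin P ((\<lambda>v. pt v t) ` V)"
proof -
  let ?T = "prod_topology E (discrete_topology UNIV :: circle topology)"
  let ?S = "(\<lambda>v. pt v t) ` V"
  have VE: "V \<subseteq> topspace E"
    using V by (rule openin_subset)
  have "openin ?T {x \<in> topspace ?T. (case x of (e, s) \<Rightarrow> pt e s) \<in> ?S}"
  proof (subst openin_subopen, intro ballI)
    fix x assume "x \<in> {x \<in> topspace ?T. (case x of (e, s) \<Rightarrow> pt e s) \<in> ?S}"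
    then obtain e s v where x: "x = (e, s)" "e \<in> topspace E" "v \<in> V" "pt e s = pt v t"
      by auto
    with VE have v: "v \<in> topspace E" "p v = p e" "s + F e = t + F v"
      by (auto simp: pt_eq_iff)
    obtain \<phi> where \<phi>: "deck_transformation E p \<phi>" "\<phi> e = v"
      using deck_transformation_exists[OF v(1) x(2) v(2)] .
    have cont: "continuous_map E E \<phi>"
      using \<phi>(1) by (simp add: deck_transformation_def homeomorphic_imp_continuous_map)
    define N where "N = {e' \<in> topspace E. \<phi> e' \<in> V}"
    have "openin ?T (N \<times> {s})"
      unfolding N_def openin_prod_Times_iff using openin_continuous_map_preimage[OF cont V] by simp
    moreover have "x \<in> N \<times> {s}"
      using x \<phi> by (simp add: N_def)
    moreover have "pt e' s \<in> ?S" if "e' \<in> N" for e'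
    proof -
      have e': "e' \<in> topspace E" "\<phi> e' \<in> V" "p (\<phi> e') = p e'"
        using that \<phi>(1) by (auto simp: N_def deck_transformation_def)
      have "F (\<phi> e') - F e' = F v - F e"
        using deck_transformation_shift[OF \<phi>(1) e'(1) x(2)] \<phi>(2) by simp
      with v(3) have "s + F e' = t + F (\<phi> e')"
        by (metis (no_types, lifting) add.assoc add.commute add_diff_cancel_left' add_diff_eq diff_add_cancel)
      then have "pt e' s = pt (\<phi> e') t"
        using e' VE by (subst pt_eq_iff) auto
      with e'(2) show ?thesis by blast
    qed
    then have "N \<times> {s} \<subseteq> {x \<in> topspace ?T. (case x of (e, s) \<Rightarrow> pt e s) \<in> ?S}"
      by (auto simp: N_def)
    ultimately show "\<exists>W. openin ?T W \<and> x \<in> W \<and> W \<subseteq> {x \<in> topspace ?T. (case x of (e, s) \<Rightarrow> pt e s) \<in> ?S}"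
      by blast
  qed
  moreover have "?S \<subseteq> topspace P"
    using VE pt_in_P by blast
  ultimately show ?thesis
    using quotient_map_pt unfolding quotient_map_def by blast
qed

lemma continuous_map_pt: "continuous_map E P (\<lambda>e. pt e s)"
proof -
  have "continuous_map E (prod_topology E (discrete_topology UNIV)) (\<lambda>e. (e, s))"
    by (intro continuous_map_pairedI) auto
  from continuous_map_compose[OF this quotient_imp_continuous_map[OF quotient_map_pt]]
  show ?thesis by (simp add: o_def)
qed

text \<open>By equivariance it suffices to follow the two maps along \<open>e \<mapsto> [e, 0]\<close>. There the difference of phases
  is locally constant: the two images stay in open horizontal sheets over the same set on which \<open>p\<close>
  is injective, and these sheets differ by a fixed translation. Connectedness of \<open>E\<close> concludes.
  Discreteness of the structure group is essential here: it makes the sheets open.\<close>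

lemma equivariant_maps_differ_by_constant:
  assumes cont: "continuous_map P P \<Phi>" "continuous_map P P \<Psi>"
    and equi: "\<And>u t. u \<in> topspace P \<Longrightarrow> \<Phi> (principal_action t u) = principal_action t (\<Phi> u)"
      "\<And>u t. u \<in> topspace P \<Longrightarrow> \<Psi> (principal_action t u) = principal_action t (\<Psi> u)"
    and same: "\<And>u. u \<in> topspace P \<Longrightarrow> bundle_proj p (\<Phi> u) = bundle_proj p (\<Psi> u)"
  obtains k where "\<And>u. u \<in> topspace P \<Longrightarrow> phase (\<Phi> u) = phase (\<Psi> u) + k"
proof -
  have into: "\<Phi> u \<in> topspace P" "\<Psi> u \<in> topspace P" if "u \<in> topspace P" for u
    using cont that by (auto simp: continuous_map_def)
  \<comment> \<open>the translation by which the two maps differ over the projection of a point; to be shown constant\<close>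
  define \<kappa> where "\<kappa> e = phase (\<Phi> (pt e 0)) - phase (\<Psi> (pt e 0))" for e
  have contE: "continuous_map E P (\<lambda>e. \<Phi> (pt e 0))" "continuous_map E P (\<lambda>e. \<Psi> (pt e 0))"
    using continuous_map_compose[OF continuous_map_pt cont(1)]
      continuous_map_compose[OF continuous_map_pt cont(2)] by (simp_all add: o_def)
  have loc: "\<exists>U. openin E U \<and> e \<in> U \<and> (\<forall>e'\<in>U. \<kappa> e' = \<kappa> e)" if e: "e \<in> topspace E" for e
  proof -
    obtain z s where z: "z \<in> topspace E" "\<Psi> (pt e 0) = pt z s"
      using P_cases[OF into(2)[OF pt_in_P[OF e]]] by metis
    have \<Phi>e: "\<Phi> (pt e 0) = pt z (s + \<kappa> e)"
    proof (rule P_eqI)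
      show "bundle_proj p (\<Phi> (pt e 0)) = bundle_proj p (pt z (s + \<kappa> e))"
        using same[OF pt_in_P[OF e]] z by (simp add: bundle_proj_pt)
      show "phase (\<Phi> (pt e 0)) = phase (pt z (s + \<kappa> e))"
        using z by (simp add: \<kappa>_def phase_pt)
    qed (use into e z pt_in_P in auto)
    obtain V where V: "openin E V" "z \<in> V" "inj_on p V"
      using covering_map_locally_injective[OF cov z(1)] .
    have VE: "V \<subseteq> topspace E"
      using V(1) by (rule openin_subset)
    obtain N where N: "openin E N" "e \<in> N" "\<And>e'. e' \<in> N \<Longrightarrow> \<Phi> (pt e' 0) \<in> (\<lambda>v. pt v (s + \<kappa> e)) ` V"
      using continuous_map_nhd[OF contE(1) openin_slice[OF V(1)] e] \<Phi>e V(2) by blast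
    obtain N' where N': "openin E N'" "e \<in> N'" "\<And>e'. e' \<in> N' \<Longrightarrow> \<Psi> (pt e' 0) \<in> (\<lambda>v. pt v s) ` V"
      using continuous_map_nhd[OF contE(2) openin_slice[OF V(1)] e] z(2) V(2) by blast
    have "\<kappa> e' = \<kappa> e" if e': "e' \<in> N \<inter> N'" for e'
    proof -
      obtain v v' where v: "v \<in> V" "\<Phi> (pt e' 0) = pt v (s + \<kappa> e)" "v' \<in> V" "\<Psi> (pt e' 0) = pt v' s"
        using N(3) N'(3) e' by blast
      have "e' \<in> topspace E"
        using e' N(1) openin_subset by blast
      then have "p v = p v'"
        using same[OF pt_in_P[of e' 0]] v VE bundle_proj_pt by (metis subset_iff)
      with V(3) v have "v = v'"
        by (auto dest: inj_onD)
      moreover have "v \<in> topspace E"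
        using v VE by blast
      ultimately show ?thesis
        using v by (simp add: \<kappa>_def[of e'] phase_pt)
    qed
    then show ?thesis
      using openin_Int[OF N(1) N'(1)] N(2) N'(2) by blast
  qed
  have const: "\<kappa> e = \<kappa> z" if "e \<in> topspace E" "z \<in> topspace E" for e z
    using locally_constant_imp_constant[OF connected loc that] .
  have diff: "phase (\<Phi> (pt e s)) = phase (\<Psi> (pt e s)) + \<kappa> e" if e: "e \<in> topspace E" for e s
  proof -
    have pt: "pt e s = principal_action s (pt e 0)"
      using e by (simp add: principal_action_pt)
    show ?thesis
      unfolding pt using e equi into pt_in_P
      by (simp add: principal_action_coordinates \<kappa>_def algebra_simps)
  qed
  show ?thesis
  proof (cases "topspace E = {}")
    case True
    then show ?thesis using that[of 0] P_cases by blast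
  next
    case False
    then obtain b where "b \<in> topspace E" by blast
    then show ?thesis
      using that[of "\<kappa> b"] diff const by (metis P_cases)
  qed
qed

section \<open>Bundle automorphisms\<close>

lemma carrier_bundle_aut_group:
  "\<Phi> \<in> carrier (bundle_aut_group E p \<rho>) \<longleftrightarrow> \<Phi> \<in> Bij (topspace P) \<and> homeomorphic_map P P \<Phi> \<and>
     (\<forall>u\<in>topspace P. \<forall>t. \<Phi> (principal_action t u) = principal_action t (\<Phi> u))"
  by (simp add: bundle_aut_group_def Let_def)

text \<open>The fibre of the bundle is a single orbit of the circle, so an equivariant map carries it to a
  single fibre and \<^const>\<open>covered_map\<close> takes its value from a singleton.\<close>

lemma bundle_proj_aut:
  assumes \<Phi>: "\<Phi> \<in> carrier (bundle_aut_group E p \<rho>)" and u: "u \<in> topspace P"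
  shows "bundle_proj p (\<Phi> u) = covered_map E p X \<rho> \<Phi> (bundle_proj p u)"
proof -
  have into: "\<Phi> v \<in> topspace P" if "v \<in> topspace P" for v
    using \<Phi> that Bij_imp_funcset unfolding carrier_bundle_aut_group by blast
  define b where "b = bundle_proj p (\<Phi> u)"
  have "bundle_proj p (\<Phi> v) = b"
    if v: "v \<in> topspace P" "bundle_proj p v = bundle_proj p u" for v
  proof -
    have "v = principal_action (phase v - phase u) u"
      by (rule P_eqI) (use u v in \<open>simp_all add: principal_action_coordinates\<close>)
    then have "\<Phi> v = principal_action (phase v - phase u) (\<Phi> u)"
      using \<Phi> u unfolding carrier_bundle_aut_group by metis
    then show ?thesis
      by (simp add: principal_action_coordinates into u b_def)
  qed
  with u have "(bundle_proj p \<circ> \<Phi>) ` {v \<in> topspace P. bundle_proj p v = bundle_proj p u} = {b}"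
    by auto
  then show ?thesis
    using bundle_proj_in[OF u] by (simp add: covered_map_def b_def)
qed

lemma covered_map_eqI:
  assumes \<Phi>: "\<Phi> \<in> carrier (bundle_aut_group E p \<rho>)" and g: "g \<in> extensional (topspace X)"
    and over: "\<And>u. u \<in> topspace P \<Longrightarrow> bundle_proj p (\<Phi> u) = g (bundle_proj p u)"
  shows "covered_map E p X \<rho> \<Phi> = g"
proof (rule extensionalityI)
  show "covered_map E p X \<rho> \<Phi> \<in> extensional (topspace X)"
    by (simp add: covered_map_def)
  fix y assume "y \<in> topspace X"
  then obtain e where "e \<in> topspace E" "p e = y"
    using p_surj by (metis imageE)
  then show "covered_map E p X \<rho> \<Phi> y = g y"
    using bundle_proj_aut[OF \<Phi> pt_in_P[of e 0]] over[OF pt_in_P[of e 0]] by (simp add: bundle_proj_pt)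
qed (rule g)

lemma subgroup_bundle_aut:
  "subgroup (carrier (bundle_aut_group E p \<rho>)) (BijGroup (topspace P))"
proof -
  interpret B: group "BijGroup (topspace P)"
    by (rule group_BijGroup)
  show ?thesis
  proof (rule B.subgroupI)
    show "carrier (bundle_aut_group E p \<rho>) \<subseteq> carrier (BijGroup (topspace P))"
      by (auto simp: carrier_bundle_aut_group BijGroup_def)
    have "homeomorphic_map P P (\<lambda>u\<in>topspace P. u)"
      by (rule homeomorphic_map_eq[of P P id]) simp_all
    then have "(\<lambda>u\<in>topspace P. u) \<in> carrier (bundle_aut_group E p \<rho>)"
      unfolding carrier_bundle_aut_group using id_Bij[of "topspace P"]
      by (simp add: principal_action_coordinates)
    then show "carrier (bundle_aut_group E p \<rho>) \<noteq> {}"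
      by blast
  next
    fix \<Phi> assume \<Phi>: "\<Phi> \<in> carrier (bundle_aut_group E p \<rho>)"
    then have Bij: "\<Phi> \<in> Bij (topspace P)" and hom: "homeomorphic_map P P \<Phi>"
      and equi: "\<And>u t. u \<in> topspace P \<Longrightarrow> \<Phi> (principal_action t u) = principal_action t (\<Phi> u)"
      by (auto simp: carrier_bundle_aut_group)
    let ?\<Psi> = "\<lambda>u\<in>topspace P. inv_into (topspace P) \<Phi> u"
    have inv: "inv\<^bsub>BijGroup (topspace P)\<^esub> \<Phi> = ?\<Psi>"
      by (rule inv_BijGroup[OF Bij])
    obtain \<Psi> where \<Psi>: "homeomorphic_maps P P \<Phi> \<Psi>"
      using hom homeomorphic_map_maps by blast
    have inj: "inj_on \<Phi> (topspace P)" and surj: "\<Phi> ` topspace P = topspace P"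
      using Bij by (auto simp: Bij_def bij_betw_def)
    have \<Psi>_eq: "\<Psi> u = inv_into (topspace P) \<Phi> u" if "u \<in> topspace P" for u
      using \<Psi> that inj by (intro inv_into_f_eq[symmetric])
        (auto simp: homeomorphic_maps_def continuous_map_def)
    have "homeomorphic_map P P ?\<Psi>"
    proof (rule homeomorphic_map_eq)
      show "homeomorphic_map P P \<Psi>"
        using \<Psi> homeomorphic_maps_map by blast
    qed (simp add: \<Psi>_eq)
    moreover have "?\<Psi> (principal_action t u) = principal_action t (?\<Psi> u)" if u: "u \<in> topspace P" for u t
    proof -
      have v: "?\<Psi> u \<in> topspace P" "\<Phi> (?\<Psi> u) = u"
        using u surj by (auto simp: inv_into_into f_inv_into_f)
      then have "\<Phi> (principal_action t (?\<Psi> u)) = principal_action t u"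
        using equi by simp
      moreover have "principal_action t (?\<Psi> u) \<in> topspace P" and tu: "principal_action t u \<in> topspace P"
        using principal_action_coordinates u v by blast+
      ultimately have "inv_into (topspace P) \<Phi> (principal_action t u) = principal_action t (?\<Psi> u)"
        by (metis inj inv_into_f_eq)
      with tu show ?thesis
        by (metis restrict_apply')
    qed
    ultimately show "inv\<^bsub>BijGroup (topspace P)\<^esub> \<Phi> \<in> carrier (bundle_aut_group E p \<rho>)"
      unfolding inv carrier_bundle_aut_group using restrict_inv_into_Bij[OF Bij] by blast
  next
    fix \<Phi> \<Psi> assume mem: "\<Phi> \<in> carrier (bundle_aut_group E p \<rho>)" "\<Psi> \<in> carrier (bundle_aut_group E p \<rho>)"
    then have Bij: "\<Phi> \<in> Bij (topspace P)" "\<Psi> \<in> Bij (topspace P)"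
      and hom: "homeomorphic_map P P \<Phi>" "homeomorphic_map P P \<Psi>"
      by (auto simp: carrier_bundle_aut_group)
    have mult: "\<Phi> \<otimes>\<^bsub>BijGroup (topspace P)\<^esub> \<Psi> = compose (topspace P) \<Phi> \<Psi>"
      using Bij by (simp add: BijGroup_def)
    have "homeomorphic_map P P (compose (topspace P) \<Phi> \<Psi>)"
      by (rule homeomorphic_map_eq[OF homeomorphic_map_compose[OF hom(2,1)]]) (simp add: compose_def)
    moreover have "compose (topspace P) \<Phi> \<Psi> (principal_action t u)
        = principal_action t (compose (topspace P) \<Phi> \<Psi> u)" if "u \<in> topspace P" for u t
    proof -
      have "\<Psi> u \<in> topspace P"
        using Bij_imp_funcset[OF Bij(2)] that by blast
      then show ?thesis
        using mem that by (simp add: compose_def principal_action_coordinates carrier_bundle_aut_group)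
    qed
    ultimately show "\<Phi> \<otimes>\<^bsub>BijGroup (topspace P)\<^esub> \<Psi> \<in> carrier (bundle_aut_group E p \<rho>)"
      unfolding mult carrier_bundle_aut_group using compose_Bij[OF Bij] by blast
  qed
qed

lemma group_bundle_aut: "group (bundle_aut_group E p \<rho>)"
proof -
  have "bundle_aut_group E p \<rho> = BijGroup (topspace P)\<lparr>carrier := carrier (bundle_aut_group E p \<rho>)\<rparr>"
    by (simp add: bundle_aut_group_def Let_def)
  then show ?thesis
    using subgroup.subgroup_is_group[OF subgroup_bundle_aut group_BijGroup] by metis
qed

lemma mult_bundle_aut_group:
  assumes "\<Phi> \<in> carrier (bundle_aut_group E p \<rho>)" "\<Psi> \<in> carrier (bundle_aut_group E p \<rho>)"
    and "u \<in> topspace P"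
  shows "(\<Phi> \<otimes>\<^bsub>bundle_aut_group E p \<rho>\<^esub> \<Psi>) u = \<Phi> (\<Psi> u)"
proof -
  have "\<Phi> \<otimes>\<^bsub>bundle_aut_group E p \<rho>\<^esub> \<Psi> = compose (topspace P) \<Phi> \<Psi>"
    using assms(1,2) unfolding carrier_bundle_aut_group
    by (simp add: bundle_aut_group_def Let_def BijGroup_def)
  with assms(3) show ?thesis
    by (simp add: compose_def)
qed

text \<open>In coordinates the condition on \<open>F\<close> says that \<open>[e, s] \<mapsto> [f e, s + a]\<close> changes the phase by an amount
  depending only on the projection; hence it is well defined.\<close>

lemma lifted_map_descends:
  assumes f: "continuous_map E E f"
    and fibre: "\<And>e z. e \<in> topspace E \<Longrightarrow> z \<in> topspace E \<Longrightarrow> p e = p z \<Longrightarrow>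
      p (f e) = p (f z) \<and> F (f e) - F e = F (f z) - F z"
  obtains \<Phi> where "continuous_map P P \<Phi>" "\<And>e s. e \<in> topspace E \<Longrightarrow> \<Phi> (pt e s) = pt (f e) (s + a)"
proof -
  have fE: "f e \<in> topspace E" if "e \<in> topspace E" for e
    using f that by (auto simp: continuous_map_def)
  define \<Phi> where "\<Phi> u = the_elem ((\<lambda>(e, s). pt (f e) (s + a)) ` u)" for u
  have \<Phi>: "\<Phi> (pt e s) = pt (f e) (s + a)" if e: "e \<in> topspace E" for e s
  proof -
    define c where "c = pt (f e) (s + a)"
    have "pt (f z) (t + a) = c" if "(z, t) \<in> pt e s" for z t
    proof -
      have z: "z \<in> topspace E" "p z = p e" "t + F z = s + F e"
        using that by (auto simp: pt_eq_Collect[OF e])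
      have "F (f z) - F z = F (f e) - F e"
        using fibre[OF z(1) e z(2)] by blast
      then have "(t + a) + F (f z) = (s + a) + F (f e)"
        using z(3) by (metis (no_types, lifting) add.assoc add.commute diff_add_cancel)
      then show ?thesis
        using fibre[OF z(1) e z(2)] fE z(1) e by (simp add: pt_eq_iff c_def)
    qed
    then have "(\<lambda>(e, s). pt (f e) (s + a)) ` pt e s = (\<lambda>_. c) ` pt e s"
      by (intro image_cong refl) (clarsimp split: prod.splits)
    also have "\<dots> = {c}"
      using pt_mem[OF e, of s] by (simp add: image_constant)
    finally have "(\<lambda>(e, s). pt (f e) (s + a)) ` pt e s = {c}" .
    then show ?thesis by (simp add: \<Phi>_def c_def)
  qed
  have "continuous_map (prod_topology E (discrete_topology UNIV))
      (prod_topology E (discrete_topology UNIV)) (\<lambda>x. ((f \<circ> fst) x, ((\<lambda>s. s + a) \<circ> snd) x))"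
    by (intro continuous_map_pairedI continuous_map_compose[OF continuous_map_fst f]
        continuous_map_compose[OF continuous_map_snd]) simp
  from continuous_map_compose[OF this quotient_imp_continuous_map[OF quotient_map_pt]]
  have "continuous_map (prod_topology E (discrete_topology UNIV)) P (\<Phi> \<circ> (\<lambda>(e, s). pt e s))"
    by (rule continuous_map_eq) (auto simp: \<Phi>)
  then have "continuous_map P P \<Phi>"
    by (rule continuous_compose_quotient_map[OF quotient_map_pt])
  with \<Phi> show ?thesis by (rule that[rotated])
qed

lemma lifted_homeomorphism_descends:
  assumes ff: "homeomorphic_maps E E f f'" and g: "inj_on g (topspace X)"
    and over: "\<And>z. z \<in> topspace E \<Longrightarrow> p (f z) = g (p z)"
    and shift: "\<And>e z. e \<in> topspace E \<Longrightarrow> z \<in> topspace E \<Longrightarrow> p e = p z \<Longrightarrow> F (f e) - F e = F (f z) - F z"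
  obtains \<Phi> where "\<Phi> \<in> carrier (bundle_aut_group E p \<rho>)"
    "\<And>e s. e \<in> topspace E \<Longrightarrow> \<Phi> (pt e s) = pt (f e) (s + a)"
proof -
  have cont: "continuous_map E E f" "continuous_map E E f'"
    and inverse: "\<And>z. z \<in> topspace E \<Longrightarrow> f' (f z) = z" "\<And>z. z \<in> topspace E \<Longrightarrow> f (f' z) = z"
    using ff by (auto simp: homeomorphic_maps_def)
  have fE: "f e \<in> topspace E" "f' e \<in> topspace E" if "e \<in> topspace E" for e
    using cont that by (auto simp: continuous_map_def)
  have fibre: "p (f e) = p (f z) \<and> F (f e) - F e = F (f z) - F z"
    if "e \<in> topspace E" "z \<in> topspace E" "p e = p z" for e z
    using over[OF that(1)] over[OF that(2)] shift[OF that] that(3) by simp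
  have fibre': "p (f' e) = p (f' z) \<and> F (f' e) - F e = F (f' z) - F z"
    if ez: "e \<in> topspace E" "z \<in> topspace E" "p e = p z" for e z
  proof -
    have "g (p (f' e)) = g (p (f' z))"
      using ez over[OF fE(2)] inverse(2) by metis
    then have same: "p (f' e) = p (f' z)"
      using g fE(2) ez(1,2) p_in by (meson inj_onD)
    have "F e - F (f' e) = F z - F (f' z)"
      using shift[OF fE(2) fE(2) same] ez(1,2) inverse(2) by simp
    with same show ?thesis
      by (metis minus_diff_eq)
  qed
  obtain \<Phi> where \<Phi>: "continuous_map P P \<Phi>" "\<And>e s. e \<in> topspace E \<Longrightarrow> \<Phi> (pt e s) = pt (f e) (s + a)"
    using lifted_map_descends[OF cont(1) fibre] by blast
  obtain \<Psi> where \<Psi>: "continuous_map P P \<Psi>" "\<And>e s. e \<in> topspace E \<Longrightarrow> \<Psi> (pt e s) = pt (f' e) (s + (- a))"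
    using lifted_map_descends[OF cont(2) fibre'] by blast
  have "homeomorphic_maps P P \<Phi> \<Psi>"
    unfolding homeomorphic_maps_def using \<Phi> \<Psi> fE inverse by (auto elim!: P_cases)
  then have hom: "homeomorphic_map P P \<Phi>"
    using homeomorphic_maps_map by blast
  let ?\<Phi> = "restrict \<Phi> (topspace P)"
  have hom': "homeomorphic_map P P ?\<Phi>"
    by (rule homeomorphic_map_eq[OF hom]) simp
  then have "?\<Phi> \<in> Bij (topspace P)"
    by (auto simp: Bij_def bij_betw_def homeomorphic_eq_everything_map)
  moreover have "?\<Phi> (principal_action t u) = principal_action t (?\<Phi> u)" if u: "u \<in> topspace P" for u t
  proof -
    obtain e s where u: "e \<in> topspace E" "u = pt e s"
      using u by (rule P_cases)
    show ?thesis
      using u fE(1)[OF u(1)] by (simp add: principal_action_pt pt_in_P \<Phi>(2) add.commute add.left_commute)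
  qed
  ultimately have "?\<Phi> \<in> carrier (bundle_aut_group E p \<rho>)"
    using hom' by (simp add: carrier_bundle_aut_group)
  moreover have "?\<Phi> (pt e s) = pt (f e) (s + a)" if "e \<in> topspace E" for e s
    using \<Phi>(2)[OF that] pt_in_P[OF that] by simp
  ultimately show ?thesis by (rule that)
qed

lemma bundle_translation:
  shows "bundle_translation E p \<rho> a \<in> carrier (bundle_aut_group E p \<rho>)"
    and "u \<in> topspace P \<Longrightarrow> bundle_translation E p \<rho> a u = principal_action a u"
proof -
  have "homeomorphic_maps E E id id"
    by (simp add: homeomorphic_maps_def)
  then obtain \<Phi> where \<Phi>: "\<Phi> \<in> carrier (bundle_aut_group E p \<rho>)"
    "\<And>e s. e \<in> topspace E \<Longrightarrow> \<Phi> (pt e s) = pt (id e) (s + a)"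
    by (rule lifted_homeomorphism_descends[where g = id and a = a]) auto
  have "bundle_translation E p \<rho> a = \<Phi>"
  proof (rule extensionalityI)
    show "bundle_translation E p \<rho> a \<in> extensional (topspace P)"
      by (simp add: bundle_translation_def)
    show "\<Phi> \<in> extensional (topspace P)"
      using \<Phi>(1) by (simp add: carrier_bundle_aut_group Bij_def)
    show "bundle_translation E p \<rho> a u = \<Phi> u" if "u \<in> topspace P" for u
      using that by (auto elim!: P_cases simp: bundle_translation_def \<Phi>(2) principal_action_pt pt_in_P)
  qed
  with \<Phi>(1) show "bundle_translation E p \<rho> a \<in> carrier (bundle_aut_group E p \<rho>)"
    by simp
  show "u \<in> topspace P \<Longrightarrow> bundle_translation E p \<rho> a u = principal_action a u"
    by (simp add: bundle_translation_def)
qed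

text \<open>Each homeomorphism \<open>g\<close> for which \<open>g\<^sup>*\<alpha> - \<alpha>\<close> has a potential lifts to the bundle, by descending a
  lift of \<open>g\<close> to \<open>E\<close>. The lift changes phases by the potential, up to a constant.\<close>

lemma aut_over_homeomorphism:
  assumes ne: "topspace X \<noteq> {}" and g: "g \<in> extensional (topspace X)" "homeomorphic_map X X g"
    and K: "\<And>\<gamma>. pathin X \<gamma> \<Longrightarrow>
      \<alpha> (path_simplex (g \<circ> \<gamma>)) - \<alpha> (path_simplex \<gamma>) = K (\<gamma> 1) - K (\<gamma> 0)"
  obtains \<Phi> k where "\<Phi> \<in> carrier (bundle_aut_group E p \<rho>)" "covered_map E p X \<rho> \<Phi> = g"
    "\<And>u. u \<in> topspace P \<Longrightarrow> phase (\<Phi> u) = phase u + K (bundle_proj p u) + k"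
proof -
  obtain b where b: "b \<in> topspace E"
    using ne p_surj by blast
  have "g (p b) \<in> topspace X"
    using g(2) p_in[OF b] by (auto simp: homeomorphic_eq_everything_map)
  then obtain b' where b': "b' \<in> topspace E" "p b' = g (p b)"
    using p_surj by (metis imageE)
  obtain f f' where ff: "homeomorphic_maps E E f f'" and over: "\<And>z. z \<in> topspace E \<Longrightarrow> p (f z) = g (p z)"
    using universal_covering_lift_homeomorphism[OF univ g(2) b b'] by blast
  have f: "continuous_map E E f"
    using ff by (simp add: homeomorphic_maps_def)
  have shift: "F (f e) - F e - K (p e) = F (f z) - F z - K (p z)"
    if "e \<in> topspace E" "z \<in> topspace E" for e z
    using path_increment_lift_constant[where \<alpha> = \<alpha> and p = p and F = F and X = X and g = g and K = K,
        OF primitive K p_continuous path_connected f over that] .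
  have "inj_on g (topspace X)"
    using g(2) by (simp add: homeomorphic_eq_everything_map)
  from lifted_homeomorphism_descends[where a = 0, OF ff this over]
  obtain \<Phi> where \<Phi>: "\<Phi> \<in> carrier (bundle_aut_group E p \<rho>)"
    "\<And>e s. e \<in> topspace E \<Longrightarrow> \<Phi> (pt e s) = pt (f e) (s + 0)"
    using shift by (metis (no_types, lifting) diff_add_cancel)
  have fE: "f e \<in> topspace E" if "e \<in> topspace E" for e
    using f that by (auto simp: continuous_map_def)
  have "bundle_proj p (\<Phi> u) = g (bundle_proj p u)" if "u \<in> topspace P" for u
    using that by (auto elim!: P_cases simp: \<Phi>(2) bundle_proj_pt fE over)
  then have "covered_map E p X \<rho> \<Phi> = g"
    by (rule covered_map_eqI[OF \<Phi>(1) g(1)])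
  moreover have "phase (\<Phi> u) = phase u + K (bundle_proj p u) + (F (f b) - F b - K (p b))"
    if u: "u \<in> topspace P" for u
  proof -
    obtain e s where u: "e \<in> topspace E" "u = pt e s"
      using u by (rule P_cases)
    show ?thesis
      using u by (simp add: \<Phi>(2) phase_pt bundle_proj_pt fE flip: shift[OF u(1) b])
  qed
  ultimately show ?thesis by (rule that[OF \<Phi>(1)])
qed

text \<open>By rigidity the same formula holds for every automorphism over \<open>g\<close>.\<close>

lemma aut_phase:
  assumes ne: "topspace X \<noteq> {}" and g: "g \<in> extensional (topspace X)" "homeomorphic_map X X g"
    and K: "\<And>\<gamma>. pathin X \<gamma> \<Longrightarrow>
      \<alpha> (path_simplex (g \<circ> \<gamma>)) - \<alpha> (path_simplex \<gamma>) = K (\<gamma> 1) - K (\<gamma> 0)"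
    and \<Phi>: "\<Phi> \<in> carrier (bundle_aut_group E p \<rho>)" "covered_map E p X \<rho> \<Phi> = g"
  obtains k where "\<And>u. u \<in> topspace P \<Longrightarrow> phase (\<Phi> u) = phase u + K (bundle_proj p u) + k"
proof -
  obtain \<Psi> k where \<Psi>: "\<Psi> \<in> carrier (bundle_aut_group E p \<rho>)" "covered_map E p X \<rho> \<Psi> = g"
    "\<And>u. u \<in> topspace P \<Longrightarrow> phase (\<Psi> u) = phase u + K (bundle_proj p u) + k"
    using aut_over_homeomorphism[OF ne g K] by blast
  have cont: "continuous_map P P \<Phi>" "continuous_map P P \<Psi>"
    using \<Phi>(1) \<Psi>(1) by (auto simp: carrier_bundle_aut_group homeomorphic_imp_continuous_map)
  have equi: "\<And>u t. u \<in> topspace P \<Longrightarrow> \<Phi> (principal_action t u) = principal_action t (\<Phi> u)"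
    "\<And>u t. u \<in> topspace P \<Longrightarrow> \<Psi> (principal_action t u) = principal_action t (\<Psi> u)"
    using \<Phi>(1) \<Psi>(1) by (auto simp: carrier_bundle_aut_group)
  have same: "bundle_proj p (\<Phi> u) = bundle_proj p (\<Psi> u)" if "u \<in> topspace P" for u
    using bundle_proj_aut[OF \<Phi>(1) that] bundle_proj_aut[OF \<Psi>(1) that] \<Phi>(2) \<Psi>(2) by simp
  obtain l where "\<And>u. u \<in> topspace P \<Longrightarrow> phase (\<Phi> u) = phase (\<Psi> u) + l"
    using equivariant_maps_differ_by_constant[OF cont equi same] by blast
  then show ?thesis
    using \<Psi>(3) that[of "k + l"] by (simp add: add.assoc)
qed

end

section \<open>Degree one classes and their potentials\<close>

text \<open>The three vertices of a 2-simplex each occur twice, with opposite signs.\<close>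

lemma cobdry_1_cobdry_0:
  fixes \<kappa> :: "('a, 'c::ab_group_add) cochain"
  shows "cobdry 1 X (cobdry 0 X \<kappa>) = (\<lambda>\<sigma>. 0)"
proof
  fix \<sigma> :: "(nat \<Rightarrow> real) \<Rightarrow> 'a"
  have face1: "simplical_face i u \<in> standard_simplex 1" if "u \<in> standard_simplex 0" "i \<le> 1" for i u
    using simplical_face_in_standard_simplex[of 1 i u] that by simp
  have faces: "singular_face 1 i (singular_face 2 j \<sigma>) = (\<lambda>u\<in>standard_simplex 0. \<sigma> (simplical_face j (simplical_face i u)))"
    if "i \<le> 1" for i j
    unfolding singular_face_def by (rule ext) (use face1[OF _ that] in simp)
  have swap: "simplical_face (Suc j) (simplical_face i u) = simplical_face i (simplical_face j u)"
    if "i \<le> j" for i j and u :: "nat \<Rightarrow> real"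
    using that by (auto simp: simplical_face_def fun_eq_iff)
  have vertices:
    "singular_face 1 0 (singular_face 2 1 \<sigma>) = singular_face 1 0 (singular_face 2 0 \<sigma>)"
    "singular_face 1 0 (singular_face 2 2 \<sigma>) = singular_face 1 1 (singular_face 2 0 \<sigma>)"
    "singular_face 1 1 (singular_face 2 2 \<sigma>) = singular_face 1 1 (singular_face 2 1 \<sigma>)"
    using swap[of 0 0] swap[of 0 1] swap[of 1 1]
    by (simp_all add: faces[unfolded One_nat_def numeral_2_eq_2] numeral_2_eq_2)
  show "cobdry 1 X (cobdry 0 X \<kappa>) \<sigma> = 0"
  proof (cases "singular_simplex 2 X \<sigma>")
    case True
    have "singular_simplex 1 X (singular_face 2 j \<sigma>)" if "j \<le> 2" for j
      using singular_simplex_singular_face[OF True _ that] by simp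
    then have d: "cobdry 0 X \<kappa> (singular_face 2 j \<sigma>)
        = \<kappa> (singular_face 1 0 (singular_face 2 j \<sigma>)) - \<kappa> (singular_face 1 1 (singular_face 2 j \<sigma>))"
      if "j \<le> 2" for j
      using that by (simp add: cobdry_def)
    have "Suc 1 = (2::nat)" "{..2::nat} = {0, 1, 2}"
      by auto
    with True have "cobdry 1 X (cobdry 0 X \<kappa>) \<sigma> = cobdry 0 X \<kappa> (singular_face 2 0 \<sigma>)
        - cobdry 0 X \<kappa> (singular_face 2 1 \<sigma>) + cobdry 0 X \<kappa> (singular_face 2 2 \<sigma>)"
      by (simp add: cobdry_def[of 1] algebra_simps del: One_nat_def)
    then show ?thesis
      by (simp add: d vertices del: One_nat_def)
  next
    case False
    moreover have "Suc 1 = (2::nat)" by simp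
    ultimately show ?thesis
      by (simp add: cobdry_def[of 1] del: One_nat_def)
  qed
qed

lemma cobdry_add: "cobdry n X (\<lambda>\<sigma>. f \<sigma> + g \<sigma>) = (\<lambda>\<sigma>. cobdry n X f \<sigma> + cobdry n X g \<sigma>)"
proof
  fix \<sigma>
  show "cobdry n X (\<lambda>\<sigma>. f \<sigma> + g \<sigma>) \<sigma> = cobdry n X f \<sigma> + cobdry n X g \<sigma>"
  proof (cases "singular_simplex (Suc n) X \<sigma>")
    case True
    then show ?thesis
      unfolding cobdry_def if_P[OF True] sum.distrib[symmetric] by (intro sum.cong) auto
  qed (simp add: cobdry_def)
qed

lemma cobdry_uminus: "cobdry n X (\<lambda>\<sigma>. - f \<sigma>) = (\<lambda>\<sigma>. - cobdry n X f \<sigma>)"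
proof
  fix \<sigma>
  show "cobdry n X (\<lambda>\<sigma>. - f \<sigma>) \<sigma> = - cobdry n X f \<sigma>"
  proof (cases "singular_simplex (Suc n) X \<sigma>")
    case True
    then show ?thesis
      unfolding cobdry_def if_P[OF True] sum_negf[symmetric] by (intro sum.cong) auto
  qed (simp add: cobdry_def)
qed

lemma coboundaries_1:
  "f \<in> coboundaries 1 X \<longleftrightarrow> (\<exists>\<kappa>\<in>cochains 0 X. f = cobdry 0 X \<kappa>)"
  by (auto simp: coboundaries_def)

lemma coboundaries_1_zero: "(\<lambda>\<sigma>. 0) \<in> coboundaries 1 X"
  unfolding coboundaries_1
  by (intro bexI[of _ "\<lambda>\<sigma>. 0"]) (simp_all add: cobdry_def cochains_def fun_eq_iff)

lemma coboundaries_1_add: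
  "f \<in> coboundaries 1 X \<Longrightarrow> g \<in> coboundaries 1 X \<Longrightarrow> (\<lambda>\<sigma>. f \<sigma> + g \<sigma>) \<in> coboundaries 1 X"
  unfolding coboundaries_1
  by (elim bexE, rule_tac x="\<lambda>\<sigma>. \<kappa> \<sigma> + \<kappa>' \<sigma>" in bexI) (simp_all add: cobdry_add cochains_def)

lemma coboundaries_1_uminus:
  "f \<in> coboundaries 1 X \<Longrightarrow> (\<lambda>\<sigma>. - f \<sigma>) \<in> coboundaries 1 X"
  unfolding coboundaries_1
  by (elim bexE, rule_tac x="\<lambda>\<sigma>. - \<kappa> \<sigma>" in bexI) (simp_all add: cobdry_uminus cochains_def)

lemma cohom_class_1_mem:
  "f \<in> cohom_class 1 X a \<longleftrightarrow> (\<lambda>\<sigma>. f \<sigma> - a \<sigma>) \<in> coboundaries 1 X"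
proof
  assume "f \<in> cohom_class 1 X a"
  then obtain h where "h \<in> coboundaries 1 X" "f = (\<lambda>\<sigma>. h \<sigma> + a \<sigma>)"
    by (auto simp: cohom_class_def r_coset_def cocycle_group_def)
  then show "(\<lambda>\<sigma>. f \<sigma> - a \<sigma>) \<in> coboundaries 1 X"
    by simp
next
  assume "(\<lambda>\<sigma>. f \<sigma> - a \<sigma>) \<in> coboundaries 1 X"
  then show "f \<in> cohom_class 1 X a"
    by (auto simp: cohom_class_def r_coset_def cocycle_group_def intro!: bexI[of _ "\<lambda>\<sigma>. f \<sigma> - a \<sigma>"])
qed

lemma cohom_class_1_eq:
  assumes "b \<in> cohom_class 1 X a"
  shows "cohom_class 1 X b = cohom_class 1 X a"
proof -
  have ba: "(\<lambda>\<sigma>. b \<sigma> - a \<sigma>) \<in> coboundaries 1 X"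
    using assms by (simp only: cohom_class_1_mem)
  have "(\<lambda>\<sigma>. f \<sigma> - b \<sigma>) \<in> coboundaries 1 X \<longleftrightarrow> (\<lambda>\<sigma>. f \<sigma> - a \<sigma>) \<in> coboundaries 1 X" for f
    using coboundaries_1_add[OF _ ba, of "\<lambda>\<sigma>. f \<sigma> - b \<sigma>"]
      coboundaries_1_add[OF _ coboundaries_1_uminus[OF ba], of "\<lambda>\<sigma>. f \<sigma> - a \<sigma>"] by auto
  then show ?thesis
    by (intro Set.set_eqI) (simp only: cohom_class_1_mem)
qed

lemma cohomology_group_1_class:
  assumes "\<rho> \<in> carrier (cohomology_group 1 X)" "\<alpha> \<in> \<rho>"
  shows "\<rho> = cohom_class 1 X \<alpha>" "\<alpha> \<in> carrier (cocycle_group 1 X)"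
proof -
  obtain a where a: "a \<in> carrier (cocycle_group 1 X)" "\<rho> = cohom_class 1 X a"
    using assms(1) by (auto simp: cohomology_group_def carrier_FactGroup cohom_class_def)
  then show "\<rho> = cohom_class 1 X \<alpha>"
    using cohom_class_1_eq assms(2) by blast
  obtain \<kappa> where \<kappa>: "\<kappa> \<in> cochains 0 X" "(\<lambda>\<sigma>. \<alpha> \<sigma> - a \<sigma>) = cobdry 0 X \<kappa>"
    using assms(2) unfolding a(2) cohom_class_1_mem coboundaries_1 by blast
  have \<alpha>: "\<alpha> = (\<lambda>\<sigma>. cobdry 0 X \<kappa> \<sigma> + a \<sigma>)"
    unfolding \<kappa>(2)[symmetric] by simp
  have "cobdry 1 X \<alpha> = (\<lambda>\<sigma>. 0)"
    unfolding \<alpha> cobdry_add cobdry_1_cobdry_0 using a(1) by (simp add: cocycle_group_def)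
  moreover have "\<alpha> \<in> cochains 1 X"
    unfolding \<alpha> using a(1) by (simp add: cocycle_group_def cochains_def cobdry_def)
  ultimately show "\<alpha> \<in> carrier (cocycle_group 1 X)"
    by (simp add: cocycle_group_def)
qed

lemma loop_value_eq:
  assumes \<rho>: "\<rho> \<in> carrier (cohomology_group 1 X)" "\<alpha> \<in> \<rho>"
    and \<gamma>: "pathin X \<gamma>" "\<gamma> 1 = \<gamma> 0"
  shows "loop_value \<rho> \<gamma> = \<alpha> (path_simplex \<gamma>)"
proof -
  have "f (path_simplex \<gamma>) = \<alpha> (path_simplex \<gamma>)" if f: "f \<in> \<rho>" for f
  proof -
    obtain \<kappa> where "(\<lambda>\<sigma>. f \<sigma> - \<alpha> \<sigma>) = cobdry 0 X \<kappa>"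
      using f unfolding cohomology_group_1_class(1)[OF \<rho>] cohom_class_1_mem coboundaries_1 by blast
    then have "f (path_simplex \<gamma>) - \<alpha> (path_simplex \<gamma>) = cobdry 0 X \<kappa> (path_simplex \<gamma>)"
      by (rule fun_cong)
    then show ?thesis
      using \<gamma> by (simp add: cobdry_0_path_simplex)
  qed
  then have "(\<lambda>f. f (path_simplex \<gamma>)) ` \<rho> = (\<lambda>f. \<alpha> (path_simplex \<gamma>)) ` \<rho>"
    by (intro image_cong refl)
  also have "\<dots> = {\<alpha> (path_simplex \<gamma>)}"
    using \<rho>(2) by (rule image_constant)
  finally show ?thesis
    by (simp add: loop_value_def)
qed

lemma carrier_homeo_group:
  "g \<in> carrier (homeo_group n X C) \<longleftrightarrow>
    g \<in> Bij (topspace X) \<and> homeomorphic_map X X g \<and> pullback_class n X g C = C"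
  by (simp add: homeo_group_def)

lemma mult_homeo_group:
  assumes "g \<in> carrier (homeo_group n X C)" "h \<in> carrier (homeo_group n X C)"
  shows "g \<otimes>\<^bsub>homeo_group n X C\<^esub> h = compose (topspace X) g h"
  using assms by (simp add: homeo_group_def BijGroup_def)

lemma pullback_in_class:
  assumes "pullback_class 1 X g \<rho> = \<rho>" "f \<in> \<rho>"
  shows "pullback 1 X g f \<in> \<rho>"
proof -
  have "pullback 1 X g f \<in> cohom_class 1 X (pullback 1 X g f)"
    using coboundaries_1_zero by (simp only: cohom_class_1_mem diff_self)
  then have "pullback 1 X g f \<in> pullback_class 1 X g \<rho>"
    using assms(2) unfolding pullback_class_def by blast
  then show ?thesis
    by (simp only: assms(1))
qed

lemma pullback_compose:
  assumes "continuous_map X X h"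
  shows "pullback n X (compose (topspace X) g h) f = pullback n X h (pullback n X g f)"
proof
  fix \<sigma>
  show "pullback n X (compose (topspace X) g h) f \<sigma> = pullback n X h (pullback n X g f) \<sigma>"
  proof (cases "singular_simplex n X \<sigma>")
    case True
    then have "simplex_map n (compose (topspace X) g h) \<sigma> = simplex_map n g (simplex_map n h \<sigma>)"
      using simplex_map_eq[OF True, of "compose (topspace X) g h" "g \<circ> h"]
      by (simp add: compose_def simplex_map_compose)
    with True singular_simplex_simplex_map[OF True assms] show ?thesis
      by (simp add: pullback_def)
  qed (simp add: pullback_def)
qed

text \<open>That pullback maps representatives of the class to representatives is stable under composition; as
  the class is a coset of the coboundaries, this is already enough for the class to be preserved.\<close>

lemma homeo_group_mult_closed:
  assumes \<rho>: "\<rho> \<in> carrier (cohomology_group 1 X)" "\<alpha> \<in> \<rho>"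
    and g: "g \<in> carrier (homeo_group 1 X \<rho>)" and h: "h \<in> carrier (homeo_group 1 X \<rho>)"
  shows "g \<otimes>\<^bsub>homeo_group 1 X \<rho>\<^esub> h \<in> carrier (homeo_group 1 X \<rho>)"
proof -
  let ?gh = "compose (topspace X) g h"
  have gB: "g \<in> Bij (topspace X)" "homeomorphic_map X X g" "pullback_class 1 X g \<rho> = \<rho>"
    and hB: "h \<in> Bij (topspace X)" "homeomorphic_map X X h" "pullback_class 1 X h \<rho> = \<rho>"
    using g h by (simp_all add: carrier_homeo_group)
  have "cohom_class 1 X (pullback 1 X ?gh f) = \<rho>" if "f \<in> \<rho>" for f
  proof -
    have "pullback 1 X ?gh f \<in> \<rho>"
      unfolding pullback_compose[OF homeomorphic_imp_continuous_map[OF hB(2)]]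
      using that gB(3) hB(3) by (intro pullback_in_class)
    then show ?thesis
      using cohomology_group_1_class(1)[OF \<rho>(1)] by blast
  qed
  then have "pullback_class 1 X ?gh \<rho> = \<rho>"
    unfolding pullback_class_def using \<rho>(2) by blast
  moreover have "homeomorphic_map X X ?gh"
    by (rule homeomorphic_map_eq[OF homeomorphic_map_compose[OF hB(2) gB(2)]]) (simp add: compose_def)
  ultimately show ?thesis
    unfolding mult_homeo_group[OF g h] carrier_homeo_group using compose_Bij[OF gB(1) hB(1)] by blast
qed

text \<open>Preservation of the class of \<open>\<alpha>\<close> provides the potential, so the choice in its definition is from a
  nonempty set; evaluation on the simplex of a path gives the path integral of \<open>g\<^sup>*\<alpha> - \<alpha>\<close>.\<close>

lemma potential_path:
  assumes \<rho>: "\<rho> \<in> carrier (cohomology_group 1 X)" "\<alpha> \<in> \<rho>"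
    and g: "g \<in> carrier (homeo_group 1 X \<rho>)" and \<gamma>: "pathin X \<gamma>"
  shows "\<alpha> (path_simplex (g \<circ> \<gamma>)) - \<alpha> (path_simplex \<gamma>)
       = potential X \<alpha> g (point_simplex (\<gamma> 1)) - potential X \<alpha> g (point_simplex (\<gamma> 0))"
proof -
  have "pullback_class 1 X g \<rho> = \<rho>"
    using g by (simp add: carrier_homeo_group)
  then have "pullback 1 X g \<alpha> \<in> \<rho>"
    using \<rho>(2) by (rule pullback_in_class)
  then have "\<exists>\<kappa>. \<kappa> \<in> cochains 0 X \<and> (\<lambda>\<sigma>. pullback 1 X g \<alpha> \<sigma> - \<alpha> \<sigma>) = cobdry 0 X \<kappa>"
    unfolding cohomology_group_1_class(1)[OF \<rho>] cohom_class_1_mem coboundaries_1 by blast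
  then have "(\<lambda>\<sigma>. pullback 1 X g \<alpha> \<sigma> - \<alpha> \<sigma>) = cobdry 0 X (potential X \<alpha> g)"
    unfolding potential_def by (rule someI2_ex) blast
  then have "pullback 1 X g \<alpha> (path_simplex \<gamma>) - \<alpha> (path_simplex \<gamma>)
      = cobdry 0 X (potential X \<alpha> g) (path_simplex \<gamma>)"
    by (rule fun_cong)
  then show ?thesis
    using \<gamma> singular_simplex_path_simplex[OF \<gamma>] simplex_map_path_simplex[of g \<gamma>]
    by (simp add: cobdry_0_path_simplex pullback_def)
qed

section \<open>Cohomologous group cocycles\<close>

lemma grp_coboundaries2_add:
  assumes "f \<in> grp_coboundaries2 G" "f' \<in> grp_coboundaries2 G"
  shows "(\<lambda>g h. f g h + f' g h) \<in> grp_coboundaries2 G"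
proof -
  obtain \<kappa> \<kappa>' where "f = (\<lambda>g h. if g \<in> carrier G \<and> h \<in> carrier G then \<kappa> h - \<kappa> (g \<otimes>\<^bsub>G\<^esub> h) + \<kappa> g else 0)"
    "f' = (\<lambda>g h. if g \<in> carrier G \<and> h \<in> carrier G then \<kappa>' h - \<kappa>' (g \<otimes>\<^bsub>G\<^esub> h) + \<kappa>' g else 0)"
    using assms by (auto simp: grp_coboundaries2_def)
  then show ?thesis
    unfolding grp_coboundaries2_def
    by (intro range_eqI[of _ _ "\<lambda>g. \<kappa> g + \<kappa>' g"]) (auto simp: fun_eq_iff algebra_simps)
qed

lemma grp_coboundaries2_uminus:
  assumes "f \<in> grp_coboundaries2 G"
  shows "(\<lambda>g h. - f g h) \<in> grp_coboundaries2 G"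
proof -
  obtain \<kappa> where "f = (\<lambda>g h. if g \<in> carrier G \<and> h \<in> carrier G then \<kappa> h - \<kappa> (g \<otimes>\<^bsub>G\<^esub> h) + \<kappa> g else 0)"
    using assms by (auto simp: grp_coboundaries2_def)
  then show ?thesis
    unfolding grp_coboundaries2_def
    by (intro range_eqI[of _ _ "\<lambda>g. - \<kappa> g"]) (auto simp: fun_eq_iff algebra_simps)
qed

lemma grp_class2_mem:
  "c \<in> grp_class2 G f \<longleftrightarrow> (\<lambda>g h. c g h - f g h) \<in> grp_coboundaries2 G"
proof
  assume "c \<in> grp_class2 G f"
  then obtain b where "b \<in> grp_coboundaries2 G" "c = (\<lambda>g h. b g h + f g h)"
    by (auto simp: grp_class2_def r_coset_def grp_cocycles2_def)
  then show "(\<lambda>g h. c g h - f g h) \<in> grp_coboundaries2 G"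
    by simp
next
  assume "(\<lambda>g h. c g h - f g h) \<in> grp_coboundaries2 G"
  then show "c \<in> grp_class2 G f"
    by (auto simp: grp_class2_def r_coset_def grp_cocycles2_def intro!: bexI[of _ "\<lambda>g h. c g h - f g h"])
qed

lemma grp_class2_eqI:
  assumes "(\<lambda>g h. f' g h - f g h) \<in> grp_coboundaries2 G"
  shows "grp_class2 G f' = grp_class2 G f"
proof -
  have "(\<lambda>g h. c g h - f' g h) \<in> grp_coboundaries2 G \<longleftrightarrow> (\<lambda>g h. c g h - f g h) \<in> grp_coboundaries2 G" for c
    using grp_coboundaries2_add[OF _ assms, of "\<lambda>g h. c g h - f' g h"]
      grp_coboundaries2_add[OF _ grp_coboundaries2_uminus[OF assms], of "\<lambda>g h. c g h - f g h"] by auto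
  then show ?thesis
    by (intro Set.set_eqI) (simp only: grp_class2_mem)
qed

text \<open>Since \<open>(gh)\<^sup>*\<alpha> - \<alpha> = h\<^sup>*(g\<^sup>*\<alpha> - \<alpha>) + (h\<^sup>*\<alpha> - \<alpha>)\<close>, the potentials satisfy the rule of a crossed
  homomorphism up to constants, and the group cocycle identity for \<open>g\<close>, \<open>h\<close>, \<open>l\<close> compares it at \<open>x\<close> and \<open>l x\<close>.\<close>

lemma path_integral_cocycle:
  assumes conn: "path_connected_space X" and x: "x \<in> topspace X"
    and closed: "\<And>g h. g \<in> carrier G \<Longrightarrow> h \<in> carrier G \<Longrightarrow> g \<otimes>\<^bsub>G\<^esub> h \<in> carrier G"
    and mult: "\<And>g h y. g \<in> carrier G \<Longrightarrow> h \<in> carrier G \<Longrightarrow> y \<in> topspace X \<Longrightarrow> (g \<otimes>\<^bsub>G\<^esub> h) y = g (h y)"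
    and cont: "\<And>g. g \<in> carrier G \<Longrightarrow> continuous_map X X g"
    and K: "\<And>g \<gamma>. g \<in> carrier G \<Longrightarrow> pathin X \<gamma> \<Longrightarrow>
      \<alpha> (path_simplex (g \<circ> \<gamma>)) - \<alpha> (path_simplex \<gamma>) = potential X \<alpha> g (point_simplex (\<gamma> 1)) - potential X \<alpha> g (point_simplex (\<gamma> 0))"
  shows "basepoint_cocycle G X x \<alpha> \<in> carrier (grp_cocycles2 G)"
proof -
  define k where "k g y = potential X \<alpha> g (point_simplex y)" for g y
  have crossed: "k (g \<otimes>\<^bsub>G\<^esub> h) y - k (g \<otimes>\<^bsub>G\<^esub> h) x = (k g (h y) - k g (h x)) + (k h y - k h x)"
    if gh: "g \<in> carrier G" "h \<in> carrier G" and y: "y \<in> topspace X" for g h y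
  proof -
    obtain \<gamma> where \<gamma>: "pathin X \<gamma>" "\<gamma> 0 = x" "\<gamma> 1 = y"
      using conn x y unfolding path_connected_space_def by blast
    have "path_simplex ((g \<otimes>\<^bsub>G\<^esub> h) \<circ> \<gamma>) = path_simplex (g \<circ> (h \<circ> \<gamma>))"
      using path_image_subset_topspace[OF \<gamma>(1)] by (intro path_simplex_cong) (auto simp: Pi_iff mult[OF gh])
    then have "k (g \<otimes>\<^bsub>G\<^esub> h) y - k (g \<otimes>\<^bsub>G\<^esub> h) x
        = (\<alpha> (path_simplex (g \<circ> (h \<circ> \<gamma>))) - \<alpha> (path_simplex (h \<circ> \<gamma>)))
          + (\<alpha> (path_simplex (h \<circ> \<gamma>)) - \<alpha> (path_simplex \<gamma>))"
      using K[OF closed[OF gh] \<gamma>(1)] by (simp add: k_def \<gamma>(2,3))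
    also have "\<dots> = (k g (h y) - k g (h x)) + (k h y - k h x)"
      unfolding K[OF gh(1) pathin_compose[OF \<gamma>(1) cont[OF gh(2)]]] K[OF gh(2) \<gamma>(1)]
      by (simp add: k_def \<gamma>(2,3))
    finally show ?thesis .
  qed
  have "basepoint_cocycle G X x \<alpha> h l - basepoint_cocycle G X x \<alpha> (g \<otimes>\<^bsub>G\<^esub> h) l
      + basepoint_cocycle G X x \<alpha> g (h \<otimes>\<^bsub>G\<^esub> l) - basepoint_cocycle G X x \<alpha> g h = 0"
    if ghl: "g \<in> carrier G" "h \<in> carrier G" "l \<in> carrier G" for g h l
  proof -
    have "l x \<in> topspace X"
      using cont[OF ghl(3)] x by (auto simp: continuous_map_def)
    from crossed[OF ghl(1,2) this] show ?thesis
      using ghl closed mult[OF ghl(2,3) x] by (simp add: basepoint_cocycle_def flip: k_def)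
  qed
  then show ?thesis
    by (auto simp: grp_cocycles2_def basepoint_cocycle_def)
qed

section \<open>Comparison of the two classes\<close>

context flat_bundle_coordinates
begin

text \<open>Both \<open>s(g) s(h)\<close> and \<open>s(gh)\<close> cover \<open>gh\<close>, so by rigidity they differ by a translation; its amount can
  be read off from the phases over the single point \<open>x\<close>.\<close>

lemma section_cocycle_eq:
  fixes G :: "('a \<Rightarrow> 'a, 'm) monoid_scheme" and K :: "('a \<Rightarrow> 'a) \<Rightarrow> 'a \<Rightarrow> circle"
  assumes x: "x \<in> topspace X"
    and gh: "g \<in> carrier G" "h \<in> carrier G" "g \<otimes>\<^bsub>G\<^esub> h \<in> carrier G"
    and mult: "\<And>y. y \<in> topspace X \<Longrightarrow> (g \<otimes>\<^bsub>G\<^esub> h) y = g (h y)"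
    and s: "\<And>g. g \<in> carrier G \<Longrightarrow> s g \<in> carrier (bundle_aut_group E p \<rho>)"
      "\<And>g. g \<in> carrier G \<Longrightarrow> covered_map E p X \<rho> (s g) = g"
    and phase_s: "\<And>g u. g \<in> carrier G \<Longrightarrow> u \<in> topspace P \<Longrightarrow>
      phase (s g u) = phase u + K g (bundle_proj p u) + k g"
  shows "section_cocycle (bundle_translation E p \<rho>) (bundle_aut_group E p \<rho>) G s g h
       = (K g (h x) + k g) + (K h x + k h) - (K (g \<otimes>\<^bsub>G\<^esub> h) x + k (g \<otimes>\<^bsub>G\<^esub> h))"
proof -
  let ?A = "bundle_aut_group E p \<rho>" and ?\<iota> = "bundle_translation E p \<rho>" and ?gh = "g \<otimes>\<^bsub>G\<^esub> h"
  interpret A: group ?A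
    by (rule group_bundle_aut)
  have into: "\<Phi> u \<in> topspace P" if "\<Phi> \<in> carrier ?A" "u \<in> topspace P" for \<Phi> u
    using that Bij_imp_funcset unfolding carrier_bundle_aut_group by blast
  have proj: "bundle_proj p (s g' u) = g' (bundle_proj p u)"
    if "g' \<in> carrier G" "u \<in> topspace P" for g' u
    using bundle_proj_aut[OF s(1)[OF that(1)] that(2)] s(2)[OF that(1)] by simp
  obtain e where e: "e \<in> topspace E" "p e = x"
    using x p_surj by (metis imageE)
  define u where "u = pt e 0"
  have u: "u \<in> topspace P" "bundle_proj p u = x"
    using e by (simp_all add: u_def pt_in_P bundle_proj_pt)
  let ?\<Phi> = "s g \<otimes>\<^bsub>?A\<^esub> s h"
  have \<Phi>: "?\<Phi> \<in> carrier ?A" "\<And>v. v \<in> topspace P \<Longrightarrow> ?\<Phi> v = s g (s h v)"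
    using s(1) gh by (simp_all add: mult_bundle_aut_group)
  have same: "bundle_proj p (?\<Phi> v) = bundle_proj p (s ?gh v)" if "v \<in> topspace P" for v
    using that \<Phi>(2) proj gh into s(1) mult bundle_proj_in by simp
  have equi: "\<Phi>' (principal_action t v) = principal_action t (\<Phi>' v)"
    if "\<Phi>' \<in> carrier ?A" "v \<in> topspace P" for \<Phi>' t v
    using that by (simp add: carrier_bundle_aut_group)
  have cont: "continuous_map P P \<Phi>'" if "\<Phi>' \<in> carrier ?A" for \<Phi>'
    using that by (simp add: carrier_bundle_aut_group homeomorphic_imp_continuous_map)
  obtain a where a: "\<And>v. v \<in> topspace P \<Longrightarrow> phase (?\<Phi> v) = phase (s ?gh v) + a"
    using equivariant_maps_differ_by_constant[OF cont[OF \<Phi>(1)] cont[OF s(1)[OF gh(3)]]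
        equi[OF \<Phi>(1)] equi[OF s(1)[OF gh(3)]] same] by blast
  have "?\<Phi> = ?\<iota> a \<otimes>\<^bsub>?A\<^esub> s ?gh"
  proof (rule extensionalityI)
    have "\<Psi> \<in> extensional (topspace P)" if "\<Psi> \<in> carrier ?A" for \<Psi>
      using that by (simp add: carrier_bundle_aut_group Bij_imp_extensional)
    then show "?\<Phi> \<in> extensional (topspace P)" "?\<iota> a \<otimes>\<^bsub>?A\<^esub> s ?gh \<in> extensional (topspace P)"
      using \<Phi>(1) A.m_closed[OF bundle_translation(1) s(1)[OF gh(3)]] by blast+
    fix v assume v: "v \<in> topspace P"
    have w: "s ?gh v \<in> topspace P"
      using into s(1) gh(3) v by blast
    have "?\<Phi> v = principal_action a (s ?gh v)"
      by (rule P_eqI) (use into[OF \<Phi>(1) v] w same[OF v] a[OF v] in \<open>simp_all add: principal_action_coordinates\<close>)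
    then show "?\<Phi> v = (?\<iota> a \<otimes>\<^bsub>?A\<^esub> s ?gh) v"
      by (simp add: mult_bundle_aut_group bundle_translation w s(1) gh(3) v)
  qed
  then have \<iota>a: "?\<iota> a = s g \<otimes>\<^bsub>?A\<^esub> s h \<otimes>\<^bsub>?A\<^esub> inv\<^bsub>?A\<^esub> s ?gh"
    using A.inv_solve_right[of "?\<iota> a" ?\<Phi> "s ?gh"] bundle_translation(1) \<Phi>(1) s(1) gh(3) by simp
  have inj: "b = a" if "?\<iota> b = ?\<iota> a" for b
  proof -
    have "phase (?\<iota> b u) = phase (?\<iota> a u)"
      using that by simp
    then show ?thesis
      using u(1) by (simp add: bundle_translation(2) principal_action_coordinates)
  qed
  have "section_cocycle ?\<iota> ?A G s g h = a"
    unfolding section_cocycle_def using gh(1,2) \<iota>a[symmetric] inj by (auto intro!: the_equality)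
  moreover have "phase (s g (s h u)) = phase (s ?gh u) + a"
    using a[OF u(1)] \<Phi>(2)[OF u(1)] by simp
  then have "phase u + K h x + k h + K g (h x) + k g = phase u + K ?gh x + k ?gh + a"
    using phase_s[OF gh(1) into[OF s(1)[OF gh(2)] u(1)]] phase_s[OF gh(2) u(1)] phase_s[OF gh(3) u(1)]
      proj[OF gh(2) u(1)] u(2) by simp
  ultimately show ?thesis
    by (simp add: algebra_simps)
qed

end

theorem theorem4p4:
  fixes X :: "'a topology" and E :: "'b topology" and p :: "'b \<Rightarrow> 'a"
    and c :: "('a, int) cochain set" and \<rho> :: "('a, circle) cochain set"
    and \<alpha> :: "('a, circle) cochain" and x :: 'a
    and G :: "('a \<Rightarrow> 'a) monoid"
  assumes "connected_space X"
    and "universal_covering E p X"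
    and "trivial_group (cohomology_group 1 X :: ('a, int) cochain set monoid)"
    and "c \<in> carrier (cohomology_group 2 X)"
    and "c \<noteq> \<one>\<^bsub>cohomology_group 2 X\<^esub>"
    and "coeff_map 2 X real_of_int c = \<one>\<^bsub>cohomology_group 2 X\<^esub>"
    and G_def: "G = homeo_group 2 X c"
    and "\<rho> \<in> carrier (cohomology_group 1 X)"
    and "connecting_hom 1 X \<rho> = c"
    and G_preserves: "homeo_group 1 X \<rho> = G"
    and "\<alpha> \<in> \<rho>"
    and "x \<in> topspace X"
  shows "grp_class2 G (basepoint_cocycle G X x \<alpha>) \<in> carrier (grp_cohomology2 G)
       \<and> grp_class2 G (basepoint_cocycle G X x \<alpha>) = aut_extension_class E p X \<rho> G"
proof -
  have \<rho>: "\<rho> \<in> carrier (cohomology_group 1 X)" "\<alpha> \<in> \<rho>" and x: "x \<in> topspace X"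
    using assms by auto
  have univ: "universal_covering E p X"
    by (rule assms)
  have \<alpha>: "\<alpha> \<in> carrier (cocycle_group 1 X)"
    by (rule cohomology_group_1_class(2)[OF \<rho>])
  have p: "continuous_map E X p" "p ` topspace E = topspace X" and E: "simply_connected_space E"
    using univ by (auto simp: universal_covering_def covering_map_def)
  obtain F where F: "\<And>\<gamma>. pathin E \<gamma> \<Longrightarrow> \<alpha> (path_simplex (p \<circ> \<gamma>)) = F (\<gamma> 1) - F (\<gamma> 0)"
    using simply_connected_cocycle_primitive[OF \<alpha> p(1) E] by blast
  interpret flat_bundle_coordinates E p X \<rho> \<alpha> F
    by unfold_locales (use univ F loop_value_eq[OF \<rho>] in auto)
  let ?A = "bundle_aut_group E p \<rho>" and ?\<iota> = "bundle_translation E p \<rho>" and ?\<pi> = "covered_map E p X \<rho>"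
  have g: "g \<in> extensional (topspace X)" "homeomorphic_map X X g" if "g \<in> carrier G" for g
    using that by (simp_all add: carrier_homeo_group Bij_imp_extensional flip: G_preserves)
  have closed: "g \<otimes>\<^bsub>G\<^esub> h \<in> carrier G" if "g \<in> carrier G" "h \<in> carrier G" for g h
    using homeo_group_mult_closed[OF \<rho>] that by (simp only: G_preserves)
  have mult: "(g \<otimes>\<^bsub>G\<^esub> h) y = g (h y)" if "g \<in> carrier G" "h \<in> carrier G" "y \<in> topspace X" for g h y
    using mult_homeo_group[of g 1 X \<rho> h, unfolded G_preserves] that by (simp add: compose_def)
  define K where "K g y = potential X \<alpha> g (point_simplex y)" for g y
  have K: "\<alpha> (path_simplex (g \<circ> \<gamma>)) - \<alpha> (path_simplex \<gamma>) = K g (\<gamma> 1) - K g (\<gamma> 0)"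
    if "g \<in> carrier G" "pathin X \<gamma>" for g \<gamma>
    unfolding K_def using that by (intro potential_path[OF \<rho>]) (simp_all only: G_preserves)
  have "path_connected_space X"
    unfolding path_connected_space_def
  proof (intro ballI)
    fix y y' assume "y \<in> topspace X" "y' \<in> topspace X"
    then obtain e e' where e: "e \<in> topspace E" "p e = y" "e' \<in> topspace E" "p e' = y'"
      using p(2) by (metis imageE)
    then obtain \<gamma> where \<gamma>: "pathin E \<gamma>" "\<gamma> 0 = e" "\<gamma> 1 = e'"
      using path_connected unfolding path_connected_space_def by blast
    show "\<exists>\<gamma>. pathin X \<gamma> \<and> \<gamma> 0 = y \<and> \<gamma> 1 = y'"
      using pathin_compose[OF \<gamma>(1) p(1)] \<gamma> e by (intro exI[of _ "p \<circ> \<gamma>"]) simp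
  qed
  then have "basepoint_cocycle G X x \<alpha> \<in> carrier (grp_cocycles2 G)"
    using x closed mult homeomorphic_imp_continuous_map[OF g(2)] K[unfolded K_def]
    by (rule path_integral_cocycle)
  then have in_H2: "grp_class2 G (basepoint_cocycle G X x \<alpha>) \<in> carrier (grp_cohomology2 G)"
    unfolding grp_cohomology2_def carrier_FactGroup grp_class2_def by blast
  have ne: "topspace X \<noteq> {}"
    using x by blast
  have all_sections: "grp_class2 G (section_cocycle ?\<iota> ?A G s) = grp_class2 G (basepoint_cocycle G X x \<alpha>)"
    if s: "s \<in> carrier G \<rightarrow> carrier ?A" "\<forall>g\<in>carrier G. ?\<pi> (s g) = g" for s
  proof (rule grp_class2_eqI)
    have s': "s g \<in> carrier ?A" "?\<pi> (s g) = g" if "g \<in> carrier G" for g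
      using s that by auto
    have "\<forall>g\<in>carrier G. \<exists>k. \<forall>u\<in>topspace P. phase (s g u) = phase u + K g (bundle_proj p u) + k"
    proof
      fix g' assume g': "g' \<in> carrier G"
      obtain k where "\<And>u. u \<in> topspace P \<Longrightarrow> phase (s g' u) = phase u + K g' (bundle_proj p u) + k"
        using aut_phase[OF ne g[OF g'] K[OF g'] s'[OF g']] by blast
      then show "\<exists>k. \<forall>u\<in>topspace P. phase (s g' u) = phase u + K g' (bundle_proj p u) + k"
        by blast
    qed
    from bchoice[OF this] obtain k where k: "\<And>g u. g \<in> carrier G \<Longrightarrow> u \<in> topspace P \<Longrightarrow>
        phase (s g u) = phase u + K g (bundle_proj p u) + k g"
      by blast
    \<comment> \<open>the cochain whose coboundary is the difference: phase change over the base point\<close>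
    define \<kappa> where "\<kappa> g = K g x + k g" for g
    have "section_cocycle ?\<iota> ?A G s g h - basepoint_cocycle G X x \<alpha> g h
        = \<kappa> h - \<kappa> (g \<otimes>\<^bsub>G\<^esub> h) + \<kappa> g" if gh: "g \<in> carrier G" "h \<in> carrier G" for g h
    proof -
      have "section_cocycle ?\<iota> ?A G s g h
          = (K g (h x) + k g) + (K h x + k h) - (K (g \<otimes>\<^bsub>G\<^esub> h) x + k (g \<otimes>\<^bsub>G\<^esub> h))"
        using x gh closed[OF gh] mult[OF gh] s' k by (rule section_cocycle_eq)
      then show ?thesis
        using gh by (simp add: basepoint_cocycle_def \<kappa>_def K_def algebra_simps)
    qed
    then have "(\<lambda>g h. section_cocycle ?\<iota> ?A G s g h - basepoint_cocycle G X x \<alpha> g h)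
        = (\<lambda>g h. if g \<in> carrier G \<and> h \<in> carrier G then \<kappa> h - \<kappa> (g \<otimes>\<^bsub>G\<^esub> h) + \<kappa> g else 0)"
      by (auto simp: fun_eq_iff section_cocycle_def basepoint_cocycle_def)
    then show "(\<lambda>g h. section_cocycle ?\<iota> ?A G s g h - basepoint_cocycle G X x \<alpha> g h) \<in> grp_coboundaries2 G"
      unfolding grp_coboundaries2_def by (rule range_eqI[where x = \<kappa>])
  qed
  have "\<exists>\<Phi>. \<Phi> \<in> carrier ?A \<and> ?\<pi> \<Phi> = g" if "g \<in> carrier G" for g
    using aut_over_homeomorphism[OF ne g[OF that] K[OF that]] by blast
  then obtain s where s: "s \<in> carrier G \<rightarrow> carrier ?A" "\<forall>g\<in>carrier G. ?\<pi> (s g) = g"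
    by (metis Pi_I')
  have "{grp_class2 G (section_cocycle ?\<iota> ?A G s) | s. s \<in> carrier G \<rightarrow> carrier ?A \<and> (\<forall>g\<in>carrier G. ?\<pi> (s g) = g)}
      = {grp_class2 G (basepoint_cocycle G X x \<alpha>)}" (is "?L = {?c}")
  proof (intro equalityI subsetI)
    fix C assume "C \<in> ?L"
    then show "C \<in> {?c}"
      using all_sections by auto
  next
    fix C assume "C \<in> {?c}"
    then have "C = grp_class2 G (section_cocycle ?\<iota> ?A G s)"
      using all_sections[OF s] by simp
    with s show "C \<in> ?L"
      by blast
  qed
  then have "aut_extension_class E p X \<rho> G = ?c"
    by (simp add: aut_extension_class_def extension_class_def)
  with in_H2 show ?thesis
    by simp
qed

end
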